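(* For every even integer $\omega\ge 2$ there exists a snark with oddness $\omega$ having fewer than $7.5\,\omega$ vertices.
   Context: A snark is a $2$-connected cubic graph that admits no proper $3$-edge-colouring. The oddness of a bridgeless cubic graph is the minimum number of odd circuits in a $2$-factor of it. *)

theory Defs
  imports Complex_Main
begin

text \<open>A graph is given by its vertex set and its edge set, an edge being the two-element set of
  its ends: finite, undirected, without loops or parallel edges.\<close>

definition simple_graph :: "'a set \<Rightarrow> 'a set set \<Rightarrow> bool" where
  "simple_graph V E \<longleftrightarrow> finite V \<and> (\<forall>e\<in>E. e \<subseteq> V \<and> card e = 2)"

definition degree :: "'a set set \<Rightarrow> 'a \<Rightarrow> nat" where
  "degree E v = card {e \<in> E. v \<in> e}"

definition regular :: "nat \<Rightarrow> 'a set \<Rightarrow> 'a set set \<Rightarrow> bool" where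
  "regular d V E \<longleftrightarrow> (\<forall>v\<in>V. degree E v = d)"

definition cubic :: "'a set \<Rightarrow> 'a set set \<Rightarrow> bool" where
  "cubic V E \<longleftrightarrow> simple_graph V E \<and> regular 3 V E"

definition connected_graph :: "'a set \<Rightarrow> 'a set set \<Rightarrow> bool" where
  "connected_graph V E \<longleftrightarrow>
     V \<noteq> {} \<and> (\<forall>u\<in>V. \<forall>v\<in>V. (u, v) \<in> {(x, y). {x, y} \<in> E}\<^sup>*)"

definition k_connected :: "nat \<Rightarrow> 'a set \<Rightarrow> 'a set set \<Rightarrow> bool" where
  "k_connected k V E \<longleftrightarrow>
     card V > k \<and>
     (\<forall>S. S \<subseteq> V \<and> card S < k \<longrightarrow> connected_graph (V - S) {e \<in> E. e \<inter> S = {}})"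

definition proper_edge_colouring :: "nat \<Rightarrow> 'a set set \<Rightarrow> ('a set \<Rightarrow> nat) \<Rightarrow> bool" where
  "proper_edge_colouring k E c \<longleftrightarrow>
     (\<forall>e\<in>E. c e < k) \<and>
     (\<forall>e\<in>E. \<forall>f\<in>E. e \<noteq> f \<and> e \<inter> f \<noteq> {} \<longrightarrow> c e \<noteq> c f)"

definition snark :: "'a set \<Rightarrow> 'a set set \<Rightarrow> bool" where
  "snark V E \<longleftrightarrow>
     cubic V E \<and> k_connected 2 V E \<and> (\<nexists>c. proper_edge_colouring 3 E c)"

text \<open>Circuits and 2-factors have no isolated vertices, so they are represented by their edge sets;
  the vertex set of a circuit \<open>C\<close> is \<open>\<Union>C\<close>, and its length is \<open>card C\<close>.\<close>

definition circuit :: "'a set set \<Rightarrow> bool" where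
  "circuit C \<longleftrightarrow>
     simple_graph (\<Union>C) C \<and> regular 2 (\<Union>C) C \<and> connected_graph (\<Union>C) C"

definition two_factor :: "'a set \<Rightarrow> 'a set set \<Rightarrow> 'a set set \<Rightarrow> bool" where
  "two_factor V E F \<longleftrightarrow> F \<subseteq> E \<and> regular 2 V F"

definition odd_circuits :: "'a set set \<Rightarrow> 'a set set set" where
  "odd_circuits F = {C. C \<subseteq> F \<and> circuit C \<and> odd (card C)}"

text \<open>Every bridgeless cubic graph, hence every snark, has a 2-factor (Petersen), and a finite graph
  has finitely many, so the minimum below is attained; for a graph without 2-factors the value
  is meaningless.\<close>

definition oddness :: "'a set \<Rightarrow> 'a set set \<Rightarrow> nat" where
  "oddness V E = Min {card (odd_circuits F) | F. two_factor V E F}"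

end

theory Submission
  imports Defs
begin

text \<open>
  A 2-factor of the Petersen graph consists of two pentagons. Hence, if an edge of a cubic graph is
  subdivided by a copy of the Petersen graph minus an edge, every 2-factor of the new graph has an
  odd circuit inside the copy if it uses the edge, and two of them otherwise. Take three edges
  forming a cut, so that every 2-factor avoids at least one of them, and replace each by a chain of
  \<open>k\<close> such copies: this costs \<open>30 k\<close> vertices and forces \<open>4 k\<close> further odd circuits. Starting from
  the Petersen graph with the three edges at a vertex this settles \<open>\<omega> = 4 k + 2\<close>; for
  \<open>\<omega> = 4 k + 4\<close> one starts from two copies of the Petersen graph minus a vertex, joined by three
  edges, and inserts one additional copy into one of these edges. The forced circuits number
  \<open>\<omega> - 1\<close>, and the number of odd circuits of a 2-factor is even, so the oddness is at least \<open>\<omega>\<close>;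
  a suitable 2-factor attains it. A proper 3-edge-colouring would yield a 2-factor without odd
  circuits.
\<close>

section \<open>Circuits of a 2-factor\<close>

abbreviation adj :: "'a set set \<Rightarrow> ('a \<times> 'a) set" where
  "adj E \<equiv> {(x, y). {x, y} \<in> E}"

definition incident :: "'a set set \<Rightarrow> 'a \<Rightarrow> 'a set set" where
  "incident E v = {e \<in> E. v \<in> e}"

lemma degree_incident: "degree E v = card (incident E v)"
  by (simp add: degree_def incident_def)

lemma incident_mono: "F \<subseteq> E \<Longrightarrow> incident F v \<subseteq> incident E v"
  by (auto simp: incident_def)

lemma sym_adj: "sym (adj E)"
  by (auto simp: sym_def insert_commute)

lemma adj_rtrancl_sym: "(x, y) \<in> (adj E)\<^sup>* \<Longrightarrow> (y, x) \<in> (adj E)\<^sup>*"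
  using sym_rtrancl[OF sym_adj] by (rule symD)

lemma adj_step: "{x, y} \<in> F \<Longrightarrow> (y, z) \<in> (adj F)\<^sup>* \<Longrightarrow> (x, z) \<in> (adj F)\<^sup>*"
  by (rule converse_rtrancl_into_rtrancl[of x y]) auto

lemma simple_graph_subset: "simple_graph V E \<Longrightarrow> F \<subseteq> E \<Longrightarrow> simple_graph V F"
  by (auto simp: simple_graph_def)

lemma simple_graph_finite_edges: "simple_graph V E \<Longrightarrow> finite E"
  by (rule finite_subset[of _ "Pow V"]) (auto simp: simple_graph_def)

lemma simple_graph_edgeE:
  assumes "simple_graph V E" "e \<in> E" "x \<in> e"
  obtains y where "e = {x, y}" "x \<noteq> y" "x \<in> V" "y \<in> V"
proof -
  have "card e = 2" "e \<subseteq> V" using assms by (auto simp: simple_graph_def)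
  then obtain a b where "e = {a, b}" "a \<noteq> b" by (auto simp: card_2_iff)
  with that \<open>e \<subseteq> V\<close> \<open>x \<in> e\<close> show thesis by (cases "x = a") (auto simp: insert_commute)
qed

text \<open>Double counting of the incident pairs of a vertex and an edge.\<close>

lemma handshake:
  assumes "simple_graph V E" and "regular d V E"
  shows "2 * card E = d * card V"
proof -
  have fin: "finite V" "finite E"
    using assms(1) simple_graph_finite_edges by (auto simp: simple_graph_def)
  have "(\<Sum>v\<in>V. card {e \<in> E. v \<in> e}) = (\<Sum>e\<in>E. card {v \<in> V. v \<in> e})"
    using fin by (intro sum_multicount_gen) auto
  moreover have "card {v \<in> V. v \<in> e} = 2" if "e \<in> E" for e
  proof -
    have "e \<subseteq> V" "card e = 2" using assms(1) that by (auto simp: simple_graph_def)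
    moreover from this have "{v \<in> V. v \<in> e} = e" by auto
    ultimately show ?thesis by simp
  qed
  moreover have "card {e \<in> E. v \<in> e} = d" if "v \<in> V" for v
    using assms(2) that by (simp add: regular_def degree_def)
  ultimately show ?thesis by (simp add: mult.commute)
qed

lemma circuit_card: "circuit C \<Longrightarrow> card C = card (\<Union>C)"
  using handshake[of "\<Union>C" C 2] by (simp add: circuit_def)

lemma circuit_nonempty: "circuit C \<Longrightarrow> \<Union>C \<noteq> {}"
  by (simp add: circuit_def connected_graph_def)

section \<open>Circuits of a 2-regular graph as its connected components\<close>

definition component :: "'a set set \<Rightarrow> 'a \<Rightarrow> 'a set" where
  "component F x = {y. (x, y) \<in> (adj F)\<^sup>*}"

definition edges_in :: "'a set set \<Rightarrow> 'a set \<Rightarrow> 'a set set" where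
  "edges_in F W = {e \<in> F. e \<subseteq> W}"

lemma component_closed:
  assumes "{y, z} \<in> F" "y \<in> component F x"
  shows "z \<in> component F x"
  using assms by (auto simp: component_def intro: rtrancl_into_rtrancl)

lemma component_eq: "y \<in> component F x \<Longrightarrow> component F y = component F x"
  by (auto simp: component_def intro: rtrancl_trans adj_rtrancl_sym)

lemma component_self: "x \<in> component F x"
  by (simp add: component_def)

context
  fixes V :: "'a set" and F :: "'a set set"
  assumes simple: "simple_graph V F" and reg: "regular 2 V F"
begin

lemma component_subset: "x \<in> V \<Longrightarrow> component F x \<subseteq> V"
proof
  fix y assume x: "x \<in> V" and "y \<in> component F x"
  then have "(x, y) \<in> (adj F)\<^sup>*" by (simp add: component_def)
  then show "y \<in> V"
    using x by (induction) (use simple in \<open>auto simp: simple_graph_def\<close>)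
qed

lemma incident_edges_in_component:
  assumes "y \<in> component F x"
  shows "incident (edges_in F (component F x)) y = incident F y"
proof -
  have "e \<subseteq> component F x" if "e \<in> F" "y \<in> e" for e
    using simple_graph_edgeE[OF simple that] component_closed assms that(1)
    by (metis empty_subsetI insert_subset)
  then show ?thesis by (auto simp: incident_def edges_in_def)
qed

lemma Union_edges_in_component:
  assumes "x \<in> V"
  shows "\<Union>(edges_in F (component F x)) = component F x"
proof
  show "\<Union>(edges_in F (component F x)) \<subseteq> component F x" by (auto simp: edges_in_def)
  show "component F x \<subseteq> \<Union>(edges_in F (component F x))"
  proof
    fix y assume y: "y \<in> component F x"
    then have "card (incident F y) = 2"
      using component_subset[OF assms] reg by (auto simp: regular_def degree_incident)
    then have "incident (edges_in F (component F x)) y \<noteq> {}"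
      using incident_edges_in_component[OF y] by auto
    then show "y \<in> \<Union>(edges_in F (component F x))" by (auto simp: incident_def)
  qed
qed

lemma circuit_component:
  assumes "x \<in> V"
  shows "circuit (edges_in F (component F x))"
proof -
  let ?W = "component F x" and ?C = "edges_in F (component F x)"
  have U: "\<Union>?C = ?W" by (rule Union_edges_in_component[OF assms])
  have "simple_graph ?W ?C"
    using simple component_subset[OF assms]
    by (auto simp: simple_graph_def edges_in_def intro: finite_subset)
  moreover have "regular 2 ?W ?C"
    using reg component_subset[OF assms] incident_edges_in_component
    by (auto simp: regular_def degree_incident)
  moreover have "connected_graph ?W ?C"
  proof -
    have reach: "(x, y) \<in> (adj ?C)\<^sup>*" if "y \<in> ?W" for y
    proof -
      from that have "(x, y) \<in> (adj F)\<^sup>*" by (simp add: component_def)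
      then show ?thesis
      proof induction
        case (step y z)
        have "y \<in> ?W" "z \<in> ?W"
          using step.hyps by (auto simp: component_def intro: rtrancl_into_rtrancl)
        with step.hyps have "(y, z) \<in> adj ?C" by (auto simp: edges_in_def)
        with step.IH show ?case by (rule rtrancl_into_rtrancl)
      qed simp
    qed
    have "(y, z) \<in> (adj ?C)\<^sup>*" if "y \<in> ?W" "z \<in> ?W" for y z
      using rtrancl_trans[OF adj_rtrancl_sym[OF reach[OF that(1)]] reach[OF that(2)]] .
    then show ?thesis
      using component_self[of x F] by (auto simp: connected_graph_def)
  qed
  ultimately show ?thesis by (simp add: circuit_def U)
qed

text \<open>Both incidence sets have two elements and one contains the other. Hence a path in
  \<open>F\<close> cannot leave the vertex set of a circuit, which is what identifies circuits with
  components below.\<close>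

lemma incident_circuit:
  assumes "circuit C" "C \<subseteq> F" "y \<in> \<Union>C"
  shows "incident C y = incident F y"
proof (rule card_subset_eq)
  have "y \<in> V" using assms simple by (auto simp: simple_graph_def)
  then show "card (incident C y) = card (incident F y)"
    using assms reg by (auto simp: circuit_def regular_def degree_incident)
  show "finite (incident F y)"
    using simple_graph_finite_edges[OF simple] by (auto simp: incident_def)
qed (use incident_mono[OF assms(2)] in auto)

lemma Union_circuit:
  assumes "circuit C" "C \<subseteq> F" "x \<in> \<Union>C"
  shows "\<Union>C = component F x"
proof
  show "\<Union>C \<subseteq> component F x"
  proof
    fix y assume "y \<in> \<Union>C"
    then have "(x, y) \<in> (adj C)\<^sup>*"
      using assms by (auto simp: circuit_def connected_graph_def)
    moreover have "adj C \<subseteq> adj F" using assms by auto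
    ultimately show "y \<in> component F x"
      unfolding component_def using rtrancl_mono by blast
  qed
  show "component F x \<subseteq> \<Union>C"
  proof
    fix y assume "y \<in> component F x"
    then have "(x, y) \<in> (adj F)\<^sup>*" by (simp add: component_def)
    then show "y \<in> \<Union>C"
    proof induction
      case (step y z)
      then have "{y, z} \<in> incident C y"
        using incident_circuit[OF assms(1,2)] by (auto simp: incident_def)
      then show ?case by (auto simp: incident_def)
    qed (use assms in auto)
  qed
qed

lemma circuit_eq_component:
  assumes "circuit C" "C \<subseteq> F" "x \<in> \<Union>C"
  shows "C = edges_in F (component F x)"
proof
  show "C \<subseteq> edges_in F (component F x)"
    using Union_circuit[OF assms] assms(2) by (auto simp: edges_in_def)
  show "edges_in F (component F x) \<subseteq> C"
  proof
    fix e assume e: "e \<in> edges_in F (component F x)"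
    then have "e \<noteq> {}" using simple by (auto simp: simple_graph_def edges_in_def)
    then obtain y where "y \<in> e" by auto
    moreover from this e have "y \<in> \<Union>C"
      using Union_circuit[OF assms] by (auto simp: edges_in_def)
    ultimately have "e \<in> incident C y"
      using e incident_circuit[OF assms(1,2)] by (auto simp: incident_def edges_in_def)
    then show "e \<in> C" by (simp add: incident_def)
  qed
qed

lemma finite_odd_circuits: "finite (odd_circuits F)"
  by (rule finite_subset[of _ "Pow F"])
    (use simple_graph_finite_edges[OF simple] in \<open>auto simp: odd_circuits_def\<close>)

text \<open>The components partition \<open>V\<close>, and a circuit has as many edges as vertices.
  So \<open>card V\<close> is the sum of all circuit lengths, whose parity is that of the number of
  odd summands.\<close>

theorem even_card_odd_circuits: "even (card (odd_circuits F)) \<longleftrightarrow> even (card V)"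
proof -
  have finV: "finite V" using simple by (simp add: simple_graph_def)
  let ?K = "component F ` V" and ?g = "edges_in F"
  have card_g: "card (?g W) = card W" if "W \<in> ?K" for W
    using that circuit_card[OF circuit_component] Union_edges_in_component by auto
  have "odd_circuits F = ?g ` {W \<in> ?K. odd (card W)}"
  proof (intro set_eqI iffI)
    fix C assume C: "C \<in> odd_circuits F"
    then have circ: "circuit C" "C \<subseteq> F" "odd (card C)" by (auto simp: odd_circuits_def)
    then obtain x where x: "x \<in> \<Union>C" using circuit_nonempty by blast
    then have "x \<in> V" using circ simple by (auto simp: simple_graph_def)
    moreover have "C = ?g (component F x)" by (rule circuit_eq_component[OF circ(1,2) x])
    ultimately show "C \<in> ?g ` {W \<in> ?K. odd (card W)}"
      using card_g[of "component F x"] circ(3) by auto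
  next
    fix C assume "C \<in> ?g ` {W \<in> ?K. odd (card W)}"
    then show "C \<in> odd_circuits F"
      using circuit_component card_g by (auto simp: odd_circuits_def) (auto simp: edges_in_def)
  qed
  moreover have "inj_on ?g ?K"
    by (rule inj_on_inverseI[of _ Union]) (use Union_edges_in_component in auto)
  ultimately have "card (odd_circuits F) = card {W \<in> ?K. odd (card W)}"
    by (auto intro!: card_image elim: inj_on_subset)
  moreover have "card V = (\<Sum>W\<in>?K. card W)"
  proof -
    have "\<Union>?K = V"
      using component_subset by (auto intro: component_self)
    moreover have "pairwise disjnt ?K"
    proof (rule pairwiseI)
      fix A B assume AB: "A \<in> ?K" "B \<in> ?K" "A \<noteq> B"
      show "disjnt A B"
      proof (rule ccontr)
        assume "\<not> disjnt A B"
        then obtain z where "z \<in> A" "z \<in> B" by (auto simp: disjnt_def)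
        with AB(1,2) have "A = component F z" "B = component F z"
          using component_eq[of z F] by auto
        with AB(3) show False by simp
      qed
    qed
    moreover have "finite W" if "W \<in> ?K" for W
      using that finite_subset[OF component_subset finV] by auto
    ultimately show ?thesis using card_Union_disjoint[of ?K] by auto
  qed
  ultimately show ?thesis
    using even_sum_iff[of ?K card] finV by auto
qed

text \<open>Every circuit is a whole component, so it contains an element of \<open>T\<close>, and
  distinct circuits contain distinct ones. This bounds the number of odd circuits from above without
  a determination of the circuits themselves.\<close>

lemma card_odd_circuits_le:
  assumes "finite T" and "\<And>x. x \<in> V \<Longrightarrow> \<exists>t\<in>T. (x, t) \<in> (adj F)\<^sup>*"
  shows "card (odd_circuits F) \<le> card T"
proof -
  have "\<exists>t. t \<in> T \<and> t \<in> \<Union>C" if "C \<in> odd_circuits F" for C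
  proof -
    have C: "circuit C" "C \<subseteq> F" using that by (auto simp: odd_circuits_def)
    then obtain x where x: "x \<in> \<Union>C" using circuit_nonempty by blast
    then have "x \<in> V" using C simple by (auto simp: simple_graph_def)
    then obtain t where "t \<in> T" "t \<in> component F x"
      using assms(2) by (auto simp: component_def)
    then show ?thesis using Union_circuit[OF C x] by auto
  qed
  then obtain r where r: "\<And>C. C \<in> odd_circuits F \<Longrightarrow> r C \<in> T \<and> r C \<in> \<Union>C"
    by metis
  have "inj_on r (odd_circuits F)"
  proof (rule inj_on_inverseI)
    fix C assume "C \<in> odd_circuits F"
    then show "edges_in F (component F (r C)) = C"
      using r[of C] circuit_eq_component[of C "r C"] by (auto simp: odd_circuits_def)
  qed
  with r show ?thesis by (intro card_inj_on_le[OF _ _ assms(1)]) auto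
qed

end

text \<open>A set that no edge of \<open>F\<close> leaves carries a 2-regular graph of its own. By
  the parity theorem, applied to that graph, the number of its odd circuits is odd and hence
  nonzero.\<close>

lemma odd_closed_set_contains_odd_circuit:
  assumes "simple_graph V F" "regular 2 V F" "W \<subseteq> V" "odd (card W)"
    and closed: "\<And>x e. x \<in> W \<Longrightarrow> e \<in> incident F x \<Longrightarrow> e \<subseteq> W"
  shows "\<exists>C \<in> odd_circuits F. \<Union>C \<subseteq> W"
proof -
  let ?G = "edges_in F W"
  have "simple_graph W ?G"
    using assms(1,3) by (auto simp: simple_graph_def edges_in_def intro: finite_subset)
  moreover have "incident ?G x = incident F x" if "x \<in> W" for x
    using closed[OF that] by (auto simp: incident_def edges_in_def)
  then have "regular 2 W ?G"
    using assms(2,3) by (auto simp: regular_def degree_incident)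
  ultimately have "odd (card (odd_circuits ?G))"
    using even_card_odd_circuits assms(4) by blast
  then have "odd_circuits ?G \<noteq> {}" by auto
  then obtain C where "C \<in> odd_circuits ?G" by auto
  then show ?thesis by (intro bexI[of _ C]) (auto simp: odd_circuits_def edges_in_def)
qed

section \<open>Three-edge-colourings and 2-factors without odd circuits\<close>

lemma cubic_colour_classes:
  assumes "cubic V E" "proper_edge_colouring 3 E c" "v \<in> V"
  shows "bij_betw c (incident E v) {..<3}"
proof -
  have "card (incident E v) = 3"
    using assms by (auto simp: cubic_def regular_def degree_incident)
  moreover have inj: "inj_on c (incident E v)"
    using assms(2) by (auto simp: inj_on_def proper_edge_colouring_def incident_def)
  moreover have "c ` incident E v \<subseteq> {..<3}"
    using assms(2) by (auto simp: proper_edge_colouring_def incident_def)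
  ultimately have "c ` incident E v = {..<3}"
    by (intro card_subset_eq) (auto simp: card_image)
  with inj show ?thesis by (simp add: bij_betw_def)
qed

text \<open>All three colours occur exactly once at each vertex, so any two colours give a 2-factor
  and any single colour a perfect matching.\<close>

lemma colour_class_card:
  assumes "cubic V E" "proper_edge_colouring 3 E c" "v \<in> V" "A \<subseteq> {..<3}"
  shows "card {e \<in> incident E v. c e \<in> A} = card A"
proof (rule bij_betw_same_card[of c])
  show "bij_betw c {e \<in> incident E v. c e \<in> A} A"
  proof (rule bij_betw_subset[OF cubic_colour_classes[OF assms(1-3)]])
    have "c ` incident E v = {..<3}"
      using cubic_colour_classes[OF assms(1-3)] by (simp add: bij_betw_def)
    moreover have "c ` {e \<in> incident E v. c e \<in> A} = c ` incident E v \<inter> A" by auto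
    ultimately show "c ` {e \<in> incident E v. c e \<in> A} = A" using assms(4) by auto
  qed auto
qed

text \<open>The colours 0 and 1 form a 2-factor on whose circuits they alternate.\<close>

lemma three_colouring_two_factor:
  assumes cub: "cubic V E" and col: "proper_edge_colouring 3 E c"
  shows "\<exists>F. two_factor V E F \<and> odd_circuits F = {}"
proof -
  let ?F = "{e \<in> E. c e \<in> {0, 1}}"
  have simple: "simple_graph V E" using cub by (simp add: cubic_def)
  have "incident ?F v = {e \<in> incident E v. c e \<in> {0, 1}}" for v
    by (auto simp: incident_def)
  then have reg: "regular 2 V ?F"
    using colour_class_card[OF cub col, of _ "{0, 1}"]
    by (auto simp: regular_def degree_incident)
  have sF: "simple_graph V ?F" by (rule simple_graph_subset[OF simple]) auto
  have "even (card C)" if C: "circuit C" "C \<subseteq> ?F" for C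
  proof -
    \<comment> \<open>Colour 0 restricts to a perfect matching of \<open>C\<close>, so
      \<open>C\<close> has an even number of vertices.\<close>
    let ?M = "{e \<in> C. c e = 0}"
    have sub: "\<Union>C \<subseteq> V" using C simple by (auto simp: simple_graph_def)
    have "incident ?M v = {e \<in> incident E v. c e \<in> {0}}" if "v \<in> \<Union>C" for v
      using incident_circuit[OF sF reg C that] by (auto simp: incident_def)
    then have "regular 1 (\<Union>C) ?M"
      using colour_class_card[OF cub col, of _ "{0}"] sub
      by (auto simp: regular_def degree_incident)
    moreover have "simple_graph (\<Union>C) ?M"
      by (rule simple_graph_subset[of _ C]) (use C in \<open>auto simp: circuit_def\<close>)
    ultimately have "2 * card ?M = card (\<Union>C)" using handshake by fastforce
    then show ?thesis using circuit_card[OF C(1)] by presburger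
  qed
  then show ?thesis
    using reg by (intro exI[of _ ?F]) (auto simp: two_factor_def odd_circuits_def)
qed

section \<open>St-numberings and 2-connectedness\<close>

lemma connected_graph_from_root:
  assumes "r \<in> W" and "\<And>x. x \<in> W \<Longrightarrow> (x, r) \<in> (adj E)\<^sup>*"
  shows "connected_graph W E"
  unfolding connected_graph_def
proof (intro conjI ballI)
  fix u v assume "u \<in> W" "v \<in> W"
  from rtrancl_trans[OF assms(2)[OF this(1)] adj_rtrancl_sym[OF assms(2)[OF this(2)]]]
  show "(u, v) \<in> (adj E)\<^sup>*" .
qed (use assms(1) in auto)

text \<open>An st-numbering: every vertex but the lowest \<open>s\<close> (highest \<open>t\<close>) has a lower (higher) neighbour.
  After deleting a vertex \<open>r\<close>, a vertex below \<open>r\<close> still descends to \<open>s\<close> and one above \<open>r\<close> ascends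
  to \<open>t\<close>, which gives 2-connectedness. Unlike 2-connectedness itself, the numbering visibly
  survives the insertions below.\<close>

definition st_ordered :: "'a set \<Rightarrow> 'a set set \<Rightarrow> ('a \<Rightarrow> real) \<Rightarrow> 'a \<Rightarrow> 'a \<Rightarrow> bool" where
  "st_ordered V E f s t \<longleftrightarrow>
     {s, t} \<in> E \<and>
     (\<forall>x\<in>V - {s}. \<exists>y. {x, y} \<in> E \<and> f y < f x) \<and>
     (\<forall>x\<in>V - {t}. \<exists>y. {x, y} \<in> E \<and> f x < f y)"

lemma st_ordered_reverse: "st_ordered V E f s t \<Longrightarrow> st_ordered V E (\<lambda>x. - f x) t s"
  by (simp add: st_ordered_def insert_commute)

text \<open>A lower neighbour of \<open>x\<close> lies strictly below every element of
  \<open>S\<close>, so a descending path from \<open>x\<close> never meets \<open>S\<close>. It can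
  end only at \<open>s\<close>, which therefore is outside \<open>S\<close> as well. The induction
  is on the number of vertices below \<open>x\<close>.\<close>

lemma st_ordered_descend:
  assumes simple: "simple_graph V E" and st: "st_ordered V E f s t"
    and "x \<in> V" "x \<notin> S" "\<And>r. r \<in> S \<Longrightarrow> f x \<le> f r"
  shows "s \<notin> S \<and> (x, s) \<in> (adj {e \<in> E. e \<inter> S = {}})\<^sup>*"
  using assms(3-)
proof (induction "card {y \<in> V. f y < f x}" arbitrary: x rule: less_induct)
  case less
  show ?case
  proof (cases "x = s")
    case False
    then obtain y where y: "{x, y} \<in> E" "f y < f x"
      using st less.prems(1) by (auto simp: st_ordered_def)
    have yV: "y \<in> V" using simple y(1) by (auto simp: simple_graph_def)
    have yS: "y \<notin> S" using less.prems(3)[of y] y(2) by auto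
    have "card {z \<in> V. f z < f y} < card {z \<in> V. f z < f x}"
      using y(2) yV simple by (intro psubset_card_mono) (auto simp: simple_graph_def)
    from less.hyps[OF this yV yS] less.prems(3) y(2)
    have "s \<notin> S" "(y, s) \<in> (adj {e \<in> E. e \<inter> S = {}})\<^sup>*" by force+
    moreover have "(x, y) \<in> adj {e \<in> E. e \<inter> S = {}}"
      using y(1) yS less.prems(2) by auto
    ultimately show ?thesis by (blast intro: converse_rtrancl_into_rtrancl)
  qed (use less.prems in auto)
qed

lemma st_ordered_2_connected:
  assumes simple: "simple_graph V E" and "card V > 2" and st: "st_ordered V E f s t"
  shows "k_connected 2 V E"
  unfolding k_connected_def
proof (intro conjI allI impI)
  fix S assume S: "S \<subseteq> V \<and> card S < 2"
  then have "finite S" using simple by (auto simp: simple_graph_def intro: finite_subset)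
  with S consider "S = {}" | r where "S = {r}"
    by (metis One_nat_def card_0_eq card_1_singletonE less_2_cases)
  then have split: "(\<forall>r\<in>S. f x \<le> f r) \<or> (\<forall>r\<in>S. f r \<le> f x)" for x
    by cases auto
  let ?E = "{e \<in> E. e \<inter> S = {}}"
  have down: "s \<notin> S \<and> (x, s) \<in> (adj ?E)\<^sup>*" if "x \<in> V - S" "\<forall>r\<in>S. f x \<le> f r" for x
    using st_ordered_descend[OF simple st, of x S] that by auto
  have up: "t \<notin> S \<and> (x, t) \<in> (adj ?E)\<^sup>*" if "x \<in> V - S" "\<forall>r\<in>S. f r \<le> f x" for x
    using st_ordered_descend[OF simple st_ordered_reverse[OF st], of x S] that by auto
  have ends: "{s, t} \<in> E" "s \<in> V" "t \<in> V"
    using st simple by (auto simp: st_ordered_def simple_graph_def)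
  have "V - S \<noteq> {}"
    using S assms(2) card_mono[OF \<open>finite S\<close>, of V] by (auto simp: Diff_eq_empty_iff)
  then have root: "t \<in> V - S \<or> s \<in> V - S"
    using split down up ends by blast
  show "connected_graph (V - S) ?E"
  \<comment> \<open>If \<open>s\<close> is deleted, no vertex can descend to it, so all ascend to
    \<open>t\<close>. Otherwise \<open>s\<close> is the root, and a vertex that can only ascend
    reaches it through \<open>t\<close> and the edge \<open>{s, t}\<close>.\<close>
  proof (cases "s \<in> S")
    case True
    then have "(x, t) \<in> (adj ?E)\<^sup>*" if "x \<in> V - S" for x
      using down[OF that] up[OF that] split[of x] by blast
    then show ?thesis using root True by (intro connected_graph_from_root[of t]) auto
  next
    case False
    have "(x, s) \<in> (adj ?E)\<^sup>*" if "x \<in> V - S" for x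
    proof (cases "\<forall>r\<in>S. f x \<le> f r")
      case no: False
      with up[OF that] split[of x] have t: "t \<notin> S" "(x, t) \<in> (adj ?E)\<^sup>*" by auto
      moreover have "(t, s) \<in> adj ?E" using ends t(1) False by (auto simp: insert_commute)
      ultimately show ?thesis by (blast intro: rtrancl_into_rtrancl)
    qed (use down[OF that] in blast)
    then show ?thesis using False ends by (intro connected_graph_from_root[of s]) auto
  qed
qed (use assms(2) in simp)

section \<open>Inserting a Petersen graph into an edge\<close>

lemma incident_simps [simp]:
  "incident {} x = {}"
  "incident (insert e A) x = (if x \<in> e then insert e (incident A x) else incident A x)"
  "incident (A \<union> B) x = incident A x \<union> incident B x"
  "incident (A - B) x = incident A x - B"
  by (auto simp: incident_def)

text \<open>The propositional form of having degree 2 at a cubic vertex. It turns the enumeration of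
  the 2-factors of a fixed small graph into a Boolean problem.\<close>

definition two_of_three :: "bool \<Rightarrow> bool \<Rightarrow> bool \<Rightarrow> bool" where
  "two_of_three a b c \<longleftrightarrow> a \<and> b \<and> \<not> c \<or> a \<and> \<not> b \<and> c \<or> \<not> a \<and> b \<and> c"

lemma two_factor_at_cubic_vertex:
  assumes "F \<subseteq> E" "card (incident F x) = 2"
    and "incident E x = {e1, e2, e3}" "card (incident E x) = 3"
  shows "two_of_three (e1 \<in> F) (e2 \<in> F) (e3 \<in> F)"
proof -
  have "incident F x = {e1, e2, e3} \<inter> F"
    using assms(1,3) by (auto simp: incident_def)
  moreover have "e1 \<noteq> e2" "e1 \<noteq> e3" "e2 \<noteq> e3"
    using assms(3,4) by (auto simp: card_insert_if split: if_splits)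
  ultimately show ?thesis
    using assms(2) by (auto simp: two_of_three_def Int_insert_left split: if_splits)
qed

text \<open>In the next two lemmas \<open>aij\<close> says that the edge between the vertices \<open>i\<close> and \<open>j\<close> of the Petersen
  graph is used. The disjuncts list its six perfect matchings, each of which is the edge boundary
  of a pentagon.\<close>

lemma petersen_minus_vertex_cases:
  assumes "two_of_three a01 a05 a09" "two_of_three a01 a12 a17" "two_of_three a12 a23 a26"
    "two_of_three a23 a34 a39" "two_of_three a34 a45 a47" "two_of_three a05 a45 a56"
    "two_of_three a26 a56 a68" "two_of_three a68 a78 a89" "two_of_three a09 a39 a89"
  shows "\<not> a17 \<and> \<not> a47 \<and> \<not> a78 \<or>
    two_of_three a17 a47 a78 \<and>
    (\<not> a01 \<and> \<not> a26 \<and> \<not> a39 \<and> \<not> a45 \<and> \<not> a78 \<or>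
     \<not> a01 \<and> \<not> a23 \<and> \<not> a47 \<and> \<not> a56 \<and> \<not> a89 \<or>
     \<not> a05 \<and> \<not> a12 \<and> \<not> a39 \<and> \<not> a47 \<and> \<not> a68 \<or>
     \<not> a09 \<and> \<not> a12 \<and> \<not> a34 \<and> \<not> a56 \<and> \<not> a78 \<or>
     \<not> a09 \<and> \<not> a17 \<and> \<not> a23 \<and> \<not> a45 \<and> \<not> a68 \<or>
     \<not> a05 \<and> \<not> a17 \<and> \<not> a26 \<and> \<not> a34 \<and> \<not> a89)"
  using assms unfolding two_of_three_def by (smt (verit))

lemma petersen_minus_edge_cases:
  assumes "two_of_three a01 a05 p" "two_of_three a01 a12 a17" "two_of_three a12 a23 a26"
    "two_of_three a23 a34 a39" "two_of_three a34 a45 a47" "two_of_three a05 a45 a56"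
    "two_of_three a26 a56 a68" "two_of_three a17 a47 a78" "two_of_three a68 a78 a89"
    "two_of_three a39 a89 q"
  shows "p = q \<and>
    (p \<and> \<not> a01 \<and> \<not> a26 \<and> \<not> a39 \<and> \<not> a45 \<and> \<not> a78 \<or>
     p \<and> \<not> a01 \<and> \<not> a23 \<and> \<not> a47 \<and> \<not> a56 \<and> \<not> a89 \<or>
     p \<and> \<not> a05 \<and> \<not> a12 \<and> \<not> a39 \<and> \<not> a47 \<and> \<not> a68 \<or>
     \<not> p \<and> \<not> a12 \<and> \<not> a34 \<and> \<not> a56 \<and> \<not> a78 \<or>
     \<not> p \<and> \<not> a17 \<and> \<not> a23 \<and> \<not> a45 \<and> \<not> a68 \<or>
     p \<and> \<not> a05 \<and> \<not> a17 \<and> \<not> a26 \<and> \<not> a34 \<and> \<not> a89)"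
  using assms unfolding two_of_three_def by (smt (verit))

text \<open>The Petersen graph on \<open>N, \<dots>, N + 9\<close>, without its edge \<open>{N, N + 9}\<close>. The labelling is an
  st-numbering, so that the copy can be inserted into an st-numbered graph.\<close>

definition petersen_minus_edge :: "nat \<Rightarrow> nat set set" where
  "petersen_minus_edge N =
     {{N, N+1}, {N, N+5}, {N+1, N+2}, {N+1, N+7}, {N+2, N+3}, {N+2, N+6}, {N+3, N+4},
      {N+3, N+9}, {N+4, N+5}, {N+4, N+7}, {N+5, N+6}, {N+6, N+8}, {N+7, N+8}, {N+8, N+9}}"

text \<open>The join of two graphs along a 2-edge-cut: \<open>{p, q}\<close> and the missing
  Petersen edge \<open>{N, N + 9}\<close> are exchanged for two connecting edges.\<close>

definition insertion :: "nat \<Rightarrow> nat \<Rightarrow> nat \<Rightarrow> nat set set \<Rightarrow> nat set set" where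
  "insertion N p q E =
     (E - {{p, q}}) \<union> {{p, N}, {q, N+9}} \<union> petersen_minus_edge N"

text \<open>Here \<open>D\<close> will consist of the edges selected for insertion; an odd circuit
  that avoids them is untouched by later insertions.\<close>

definition avoiding :: "'a set set \<Rightarrow> 'a set set \<Rightarrow> 'a set set set" where
  "avoiding F D = {C \<in> odd_circuits F. C \<inter> D = {}}"

lemma avoidingI: "C \<in> odd_circuits F \<Longrightarrow> C \<inter> D = {} \<Longrightarrow> C \<in> avoiding F D"
  by (simp add: avoiding_def)

lemma gadget_vertex_induct:
  assumes "N \<le> x" "x < N + 10"
    and "P N" "P (N+1)" "P (N+2)" "P (N+3)" "P (N+4)" "P (N+5)" "P (N+6)" "P (N+7)" "P (N+8)" "P (N+9)"
  shows "P (x :: nat)"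
proof -
  have "x = N \<or> x = N+1 \<or> x = N+2 \<or> x = N+3 \<or> x = N+4 \<or> x = N+5 \<or> x = N+6 \<or> x = N+7
   \<or> x = N+8 \<or> x = N+9" using assms(1,2) by arith
  then show ?thesis using assms(3-) by metis
qed

section \<open>A single insertion: regularity, st-numbering and 2-factors\<close>

locale edge_insertion =
  fixes V :: "nat set" and E :: "nat set set" and p q N :: nat
  assumes cubic: "cubic V E" and pq: "{p, q} \<in> E" "p \<noteq> q" and fresh: "\<And>x. x \<in> V \<Longrightarrow> x < N"
begin

abbreviation V' :: "nat set" where "V' \<equiv> V \<union> {N..<N+10}"
abbreviation E' :: "nat set set" where "E' \<equiv> insertion N p q E"

lemma simple: "simple_graph V E" and regular3: "regular 3 V E"
  using cubic by (simp_all add: cubic_def)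

lemma ends: "p \<in> V" "q \<in> V" "p < N" "q < N"
  using simple pq fresh by (auto simp: simple_graph_def)

lemma edge_below: "e \<in> E \<Longrightarrow> x \<in> e \<Longrightarrow> x < N"
  using simple fresh by (auto simp: simple_graph_def)

lemma gadget_lower_neighbour:
  assumes "N < x" "x < N + 10"
  shows "\<exists>y. N \<le> y \<and> y < x \<and> {y, x} \<in> petersen_minus_edge N"
proof -
  have "N < x \<longrightarrow> (\<exists>y. N \<le> y \<and> y < x \<and> {y, x} \<in> petersen_minus_edge N)"
    apply (rule gadget_vertex_induct[of N x])
    using assms apply (simp, simp)
    \<comment> \<open>Vacuous for the lowest vertex \<open>N\<close>; the witness is
      arbitrary.\<close>
    subgoal by (intro impI exI[of _ "N"]; simp add: petersen_minus_edge_def)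
    subgoal by (intro impI exI[of _ "N"]; simp add: petersen_minus_edge_def)
    subgoal by (intro impI exI[of _ "N+1"]; simp add: petersen_minus_edge_def)
    subgoal by (intro impI exI[of _ "N+2"]; simp add: petersen_minus_edge_def)
    subgoal by (intro impI exI[of _ "N+3"]; simp add: petersen_minus_edge_def)
    subgoal by (intro impI exI[of _ "N"]; simp add: petersen_minus_edge_def)
    subgoal by (intro impI exI[of _ "N+2"]; simp add: petersen_minus_edge_def)
    subgoal by (intro impI exI[of _ "N+1"]; simp add: petersen_minus_edge_def)
    subgoal by (intro impI exI[of _ "N+6"]; simp add: petersen_minus_edge_def)
    subgoal by (intro impI exI[of _ "N+3"]; simp add: petersen_minus_edge_def)
    done
  then show ?thesis using assms by simp
qed

lemma gadget_upper_neighbour: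
  assumes "N \<le> x" "x < N + 9"
  shows "\<exists>y. x < y \<and> {x, y} \<in> petersen_minus_edge N"
proof -
  have "x < N + 9 \<longrightarrow> (\<exists>y. x < y \<and> {x, y} \<in> petersen_minus_edge N)"
    apply (rule gadget_vertex_induct[of N x])
    using assms apply (simp, simp)
    subgoal by (intro impI exI[of _ "N+1"]; simp add: petersen_minus_edge_def)
    subgoal by (intro impI exI[of _ "N+2"]; simp add: petersen_minus_edge_def)
    subgoal by (intro impI exI[of _ "N+3"]; simp add: petersen_minus_edge_def)
    subgoal by (intro impI exI[of _ "N+4"]; simp add: petersen_minus_edge_def)
    subgoal by (intro impI exI[of _ "N+5"]; simp add: petersen_minus_edge_def)
    subgoal by (intro impI exI[of _ "N+6"]; simp add: petersen_minus_edge_def)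
    subgoal by (intro impI exI[of _ "N+8"]; simp add: petersen_minus_edge_def)
    subgoal by (intro impI exI[of _ "N+8"]; simp add: petersen_minus_edge_def)
    subgoal by (intro impI exI[of _ "N+9"]; simp add: petersen_minus_edge_def)
    \<comment> \<open>Vacuous for the highest vertex \<open>N + 9\<close>; the witness is
      arbitrary.\<close>
    subgoal by (intro impI exI[of _ "N"]; simp add: petersen_minus_edge_def)
    done
  then show ?thesis using assms by simp
qed

lemma incident_fresh: "N \<le> x \<Longrightarrow> incident E x = {}"
  using edge_below by (fastforce simp: incident_def)

lemma incident_gadget:
  "incident E' N = {{N, N+1}, {N, N+5}, {p, N}}"
  "incident E' (N+1) = {{N, N+1}, {N+1, N+2}, {N+1, N+7}}"
  "incident E' (N+2) = {{N+1, N+2}, {N+2, N+3}, {N+2, N+6}}"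
  "incident E' (N+3) = {{N+2, N+3}, {N+3, N+4}, {N+3, N+9}}"
  "incident E' (N+4) = {{N+3, N+4}, {N+4, N+5}, {N+4, N+7}}"
  "incident E' (N+5) = {{N, N+5}, {N+4, N+5}, {N+5, N+6}}"
  "incident E' (N+6) = {{N+2, N+6}, {N+5, N+6}, {N+6, N+8}}"
  "incident E' (N+7) = {{N+1, N+7}, {N+4, N+7}, {N+7, N+8}}"
  "incident E' (N+8) = {{N+6, N+8}, {N+7, N+8}, {N+8, N+9}}"
  "incident E' (N+9) = {{N+3, N+9}, {N+8, N+9}, {q, N+9}}"
  using ends by (auto simp: insertion_def petersen_minus_edge_def incident_fresh)

lemma card_incident_gadget:
  assumes "N \<le> x" "x < N + 10"
  shows "card (incident E' x) = 3"
  using assms ends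
  by (rule_tac gadget_vertex_induct[of N x]; simp only: incident_gadget)
    (auto simp: card_insert_if doubleton_eq_iff)

text \<open>At an old vertex the only change is that \<open>{p, q}\<close> gives way to a connecting
  edge, which the bijection \<open>?h\<close> records. The lemma serves for the full edge sets as
  well as for 2-factors, whether these are contracted or extended.\<close>

lemma card_incident_transfer:
  assumes "F \<subseteq> E" "F' \<subseteq> E'" "x \<in> V"
    and old: "\<And>e. e \<in> E \<Longrightarrow> e \<noteq> {p, q} \<Longrightarrow> e \<in> F' \<longleftrightarrow> e \<in> F"
    and new: "{p, N} \<in> F' \<longleftrightarrow> {p, q} \<in> F" "{q, N+9} \<in> F' \<longleftrightarrow> {p, q} \<in> F"
  shows "card (incident F' x) = card (incident F x)"
proof -
  let ?h = "\<lambda>e. if e = {p, q} then if x = p then {p, N} else {q, N+9} else e"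
  have x: "x < N" using fresh assms(3) .
  have notE: "{p, N} \<notin> E" "{q, N+9} \<notin> E" using edge_below by fastforce+
  have "inj_on ?h (incident F x)"
    using notE assms(1) by (auto simp: inj_on_def incident_def)
  moreover have "?h ` incident F x = incident F' x"
  proof (intro equalityI subsetI)
    fix e assume "e \<in> ?h ` incident F x"
    then obtain d where "e = ?h d" "d \<in> incident F x" by (rule imageE)
    then have d: "d \<in> F" "d \<in> E" "x \<in> d" using assms(1) by (auto simp: incident_def)
    show "e \<in> incident F' x"
      using old[OF d(2)] new d \<open>e = ?h d\<close> by (cases "d = {p, q}") (auto simp: incident_def)
  next
    fix e assume e: "e \<in> incident F' x"
    then have "e \<in> E'" "x \<in> e" "e \<in> F'" using assms(2) by (auto simp: incident_def)
    then consider "e \<in> E" "e \<noteq> {p, q}" | "e = {p, N}" | "e = {q, N+9}"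
      using x by (auto simp: insertion_def petersen_minus_edge_def)
    then show "e \<in> ?h ` incident F x"
    proof cases
      case 1
      then show ?thesis
        using old[of e] \<open>e \<in> F'\<close> \<open>x \<in> e\<close> by (intro image_eqI[of _ _ e]) (auto simp: incident_def)
    next
      case 2
      then have "x = p" using \<open>x \<in> e\<close> x by auto
      then show ?thesis
        using 2 new \<open>e \<in> F'\<close> by (intro image_eqI[of _ _ "{p, q}"]) (auto simp: incident_def)
    next
      case 3
      then have "x = q" using \<open>x \<in> e\<close> x by auto
      then show ?thesis
        using 3 new \<open>e \<in> F'\<close> pq by (intro image_eqI[of _ _ "{p, q}"]) (auto simp: incident_def)
    qed
  qed
  ultimately show ?thesis using card_image by fastforce
qed

lemma not_old: "{p, N} \<notin> E" "{q, N+9} \<notin> E" "e \<in> petersen_minus_edge N \<Longrightarrow> e \<notin> E"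
  using edge_below by (fastforce simp: petersen_minus_edge_def)+

lemma insertion_cubic: "cubic V' E'"
proof -
  have "simple_graph V' E'"
    using simple ends
    by (auto simp: simple_graph_def insertion_def petersen_minus_edge_def card_insert_if)
  moreover have "card (incident E' x) = 3" if "x \<in> V'" for x
  proof (cases "x \<in> V")
    case True
    have "card (incident E' x) = card (incident E x)"
      by (rule card_incident_transfer[OF _ _ True])
        (use pq in \<open>auto simp: insertion_def\<close>)
    then show ?thesis using True regular3 by (simp add: regular_def degree_incident)
  qed (use that card_incident_gadget in auto)
  ultimately show ?thesis by (simp add: cubic_def regular_def degree_incident)
qed

text \<open>The values on the copy are interpolated between those of \<open>p\<close> and
  \<open>q\<close>. Since \<open>{p, q}\<close> differs from \<open>{s, t}\<close>, the latter edge
  survives. The clause \<open>g p < g N\<close> keeps the new edge \<open>{p, N}\<close> suitable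
  for a further insertion.\<close>

lemma insertion_st_ordered:
  assumes st: "st_ordered V E f s t" and "f p < f q" "{p, q} \<noteq> {s, t}"
  shows "\<exists>g. st_ordered V' E' g s t \<and> (\<forall>x\<in>V. g x = f x) \<and> g p < g N"
proof -
  \<comment> \<open>The ten vertices of the copy cut the interval from \<open>f p\<close> to
    \<open>f q\<close> into eleven equal pieces.\<close>
  define g where
    "g x = (if x < N then f x else f p + (f q - f p) * (real (x - N) + 1) / 11)" for x
  have g_old: "x \<in> V \<Longrightarrow> g x = f x" for x using fresh by (auto simp: g_def)
  have g_mono: "g x < g y" if "N \<le> x" "x < y" for x y
    using that assms(2) by (auto simp: g_def intro!: divide_strict_right_mono mult_strict_left_mono)
  have g_p: "g p < g x" if "N \<le> x" for x
    using that ends assms(2) by (auto simp: g_def intro!: divide_pos_pos mult_pos_pos)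
  have g_q: "g x < g q" if "N \<le> x" "x < N + 10" for x
  proof -
    have "(f q - f p) * ((real (x - N) + 1) / 11) < (f q - f p) * 1"
      using that assms(2) by (intro mult_strict_left_mono) auto
    then show ?thesis using that ends by (auto simp: g_def)
  qed
  have stE: "{s, t} \<in> E'" "s \<in> V" "t \<in> V"
    using st simple assms(3) by (auto simp: st_ordered_def insertion_def simple_graph_def)
  have low: "\<exists>y. {x, y} \<in> E' \<and> g y < g x" if x: "x \<in> V'" "x \<noteq> s" for x
  proof (cases "x \<in> V")
    case True
    then obtain y where y: "{x, y} \<in> E" "f y < f x"
      using st x(2) by (auto simp: st_ordered_def)
    then have yV: "y \<in> V" using simple by (auto simp: simple_graph_def)
    show ?thesis
    proof (cases "{x, y} = {p, q}")
      case eq: True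
      then have "x = q" using y(2) assms(2) by (auto simp: doubleton_eq_iff)
      then have "{x, N+9} \<in> E'" by (simp add: insertion_def)
      then show ?thesis using g_q[of "N+9"] \<open>x = q\<close> by (intro exI[of _ "N+9"]) simp
    qed (use y yV True g_old in \<open>auto simp: insertion_def\<close>)
  next
    case False
    then consider "x = N" | "N < x" "x < N + 10" using x(1) by force
    then show ?thesis
    proof cases
      case 1
      then show ?thesis
        using g_p[of N] by (intro exI[of _ p]) (auto simp: insertion_def insert_commute)
    next
      case 2
      then obtain y where y: "N \<le> y" "y < x" "{y, x} \<in> petersen_minus_edge N"
        using gadget_lower_neighbour by blast
      then show ?thesis
        using g_mono[OF y(1,2)] by (intro exI[of _ y]) (simp add: insertion_def insert_commute)
    qed
  qed
  have high: "\<exists>y. {x, y} \<in> E' \<and> g x < g y" if x: "x \<in> V'" "x \<noteq> t" for x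
  proof (cases "x \<in> V")
    case True
    then obtain y where y: "{x, y} \<in> E" "f x < f y"
      using st x(2) by (auto simp: st_ordered_def)
    then have yV: "y \<in> V" using simple by (auto simp: simple_graph_def)
    show ?thesis
    proof (cases "{x, y} = {p, q}")
      case eq: True
      then have "x = p" using y(2) assms(2) by (auto simp: doubleton_eq_iff)
      then have "{x, N} \<in> E'" by (simp add: insertion_def)
      then show ?thesis using g_p[of N] \<open>x = p\<close> by (intro exI[of _ N]) simp
    qed (use y yV True g_old in \<open>auto simp: insertion_def\<close>)
  next
    case False
    then consider "x = N + 9" | "N \<le> x" "x < N + 9" using x(1) by force
    then show ?thesis
    proof cases
      case 1
      then show ?thesis
        using g_q[of x] by (intro exI[of _ q]) (auto simp: insertion_def insert_commute)
    next
      case 2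
      then obtain y where y: "x < y" "{x, y} \<in> petersen_minus_edge N"
        using gadget_upper_neighbour by blast
      then show ?thesis
        using g_mono[OF 2(1) y(1)] by (intro exI[of _ y]) (simp add: insertion_def)
    qed
  qed
  show ?thesis
    using stE(1) low high g_old g_p[of N] by (intro exI[of _ g]) (auto simp: st_ordered_def)
qed

lemma simple': "simple_graph V' E'"
  using insertion_cubic by (simp add: cubic_def)

text \<open>For the lower bound on the oddness. Contracting the copy loses one odd circuit if the
  2-factor passes through it and two otherwise. These lie inside the copy, so they are distinct from
  the circuits of \<open>F\<close> that avoid \<open>D\<close>, all of which persist in
  \<open>F'\<close>.\<close>

lemma contract_two_factor:
  assumes F': "two_factor V' E' F'" and D: "{p, q} \<in> D" "D \<subseteq> E"
  obtains F where "two_factor V E F"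
    and "\<And>e. e \<in> E \<Longrightarrow> e \<noteq> {p, q} \<Longrightarrow> e \<in> F \<longleftrightarrow> e \<in> F'"
    and "{p, q} \<in> F \<longleftrightarrow> {p, N} \<in> F'"
    and "card (avoiding F D) + (if {p, q} \<in> F then 1 else 2)
           \<le> card (avoiding F' (insert {p, N} (D - {{p, q}})))"
proof -
  let ?D' = "insert {p, N} (D - {{p, q}})"
  have sub: "F' \<subseteq> E'" and reg: "regular 2 V' F'" using F' by (auto simp: two_factor_def)
  have simpleF': "simple_graph V' F'" by (rule simple_graph_subset[OF simple' sub])
  have vertex: "two_of_three (e1 \<in> F') (e2 \<in> F') (e3 \<in> F')"
    if "N \<le> x" "x < N + 10" "incident E' x = {e1, e2, e3}" for x e1 e2 e3
    using that reg
    by (intro two_factor_at_cubic_vertex[OF sub _ that(3) card_incident_gadget[OF that(1,2)]])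
      (auto simp: regular_def degree_incident)
  note cases = petersen_minus_edge_cases[OF
      vertex[OF _ _ incident_gadget(1)] vertex[OF _ _ incident_gadget(2)]
      vertex[OF _ _ incident_gadget(3)] vertex[OF _ _ incident_gadget(4)]
      vertex[OF _ _ incident_gadget(5)] vertex[OF _ _ incident_gadget(6)]
      vertex[OF _ _ incident_gadget(7)] vertex[OF _ _ incident_gadget(8)]
      vertex[OF _ _ incident_gadget(9)] vertex[OF _ _ incident_gadget(10)], simplified]
  \<comment> \<open>The two connecting edges form a cut, so \<open>F'\<close> uses both or neither.
    This makes the contraction 2-regular at \<open>p\<close> and at \<open>q\<close>.\<close>
  have both: "{q, N+9} \<in> F' \<longleftrightarrow> {p, N} \<in> F'" using cases by simp
  define F where "F = (F' \<inter> E) \<union> (if {p, N} \<in> F' then {{p, q}} else {})"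
  have "{p, q} \<notin> F'" using sub pq ends by (auto simp: insertion_def petersen_minus_edge_def doubleton_eq_iff)
  then have pqF: "{p, q} \<in> F \<longleftrightarrow> {p, N} \<in> F'" by (simp add: F_def)
  have FE: "F \<subseteq> E" using pq by (auto simp: F_def)
  have same: "e \<in> F \<longleftrightarrow> e \<in> F'" if "e \<in> E" "e \<noteq> {p, q}" for e
    using that by (auto simp: F_def)
  have "card (incident F x) = 2" if "x \<in> V" for x
    using card_incident_transfer[OF FE sub that] same pqF both reg that
    by (auto simp: regular_def degree_incident)
  then have two: "two_factor V E F" using FE by (simp add: two_factor_def regular_def degree_incident)
  have simpleF: "simple_graph V F" by (rule simple_graph_subset[OF simple FE])

  have inc: "e \<in> incident E' x \<and> e \<in> F'" if "e \<in> incident F' x" for e x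
    using that sub by (auto simp: incident_def)
  define closed where "closed W \<longleftrightarrow> (\<forall>x\<in>W. \<forall>e\<in>incident F' x. e \<subseteq> W)" for W
  note ig = incident_gadget[simplified]
  let ?good = "\<lambda>W. W \<subseteq> {N..<N+10} \<and> card W = 5 \<and> closed W"
  have odd_inside: "\<exists>C \<in> avoiding F' ?D'. \<Union>C \<subseteq> W" if W: "?good W" for W
  proof -
    obtain C where C: "C \<in> odd_circuits F'" "\<Union>C \<subseteq> W"
      using odd_closed_set_contains_odd_circuit[OF simpleF' reg, of W] W
      by (auto simp: closed_def)
    have "e \<notin> ?D'" if "e \<in> C" for e
    proof
      assume "e \<in> ?D'"
      then have "p \<in> e \<or> e \<in> E" using D(2) by auto
      moreover have "e \<subseteq> {N..<N+10}" using C(2) that W by auto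
      moreover have "card e = 2"
        using that C(1) simpleF' by (auto simp: odd_circuits_def simple_graph_def)
      then have "e \<noteq> {}" by auto
      ultimately show False using ends edge_below by fastforce
    qed
    with C show ?thesis by (intro bexI[of _ C] avoidingI) auto
  qed
  \<comment> \<open>Each avoided perfect matching separates two pentagons. In \<open>c1\<close>,
    \<open>c2\<close>, \<open>c3\<close> and \<open>c6\<close> both attachment vertices
    \<open>N\<close> and \<open>N + 9\<close> lie in the same pentagon, and the other one is closed.
    In \<open>c4\<close> and \<open>c5\<close> the matching contains the missing edge and separates
    \<open>N\<close> from \<open>N + 9\<close>; as \<open>F'\<close> does not enter the copy, both
    pentagons are closed.\<close>
  have c1: "closed {N+1, N+2, N+3, N+4, N+7}" if "{N, N+1} \<notin> F'" "{N+2, N+6} \<notin> F'"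
      "{N+3, N+9} \<notin> F'" "{N+4, N+5} \<notin> F'" "{N+7, N+8} \<notin> F'"
    using that by (auto simp: closed_def ig dest!: inc)
  have c2: "closed {N+1, N+2, N+6, N+7, N+8}" if "{N, N+1} \<notin> F'" "{N+2, N+3} \<notin> F'"
      "{N+4, N+7} \<notin> F'" "{N+5, N+6} \<notin> F'" "{N+8, N+9} \<notin> F'"
    using that by (auto simp: closed_def ig dest!: inc)
  have c3: "closed {N+2, N+3, N+4, N+5, N+6}" if "{N, N+5} \<notin> F'" "{N+1, N+2} \<notin> F'"
      "{N+3, N+9} \<notin> F'" "{N+4, N+7} \<notin> F'" "{N+6, N+8} \<notin> F'"
    using that by (auto simp: closed_def ig dest!: inc)
  have c4: "closed {N+2, N+3, N+6, N+8, N+9} \<and> closed {N, N+1, N+4, N+5, N+7}"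
    if "{p, N} \<notin> F'" "{N+1, N+2} \<notin> F'" "{N+3, N+4} \<notin> F'" "{N+5, N+6} \<notin> F'" "{N+7, N+8} \<notin> F'"
    using that both by (auto simp: closed_def ig dest!: inc)
  have c5: "closed {N+3, N+4, N+7, N+8, N+9} \<and> closed {N, N+1, N+2, N+5, N+6}"
    if "{p, N} \<notin> F'" "{N+1, N+7} \<notin> F'" "{N+2, N+3} \<notin> F'" "{N+4, N+5} \<notin> F'" "{N+6, N+8} \<notin> F'"
    using that both by (auto simp: closed_def ig dest!: inc)
  have c6: "closed {N+4, N+5, N+6, N+7, N+8}" if "{N, N+5} \<notin> F'" "{N+1, N+7} \<notin> F'"
      "{N+2, N+6} \<notin> F'" "{N+3, N+4} \<notin> F'" "{N+8, N+9} \<notin> F'"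
    using that by (auto simp: closed_def ig dest!: inc)
  have one: "\<exists>W. ?good W" if "{p, N} \<in> F'"
  proof -
    have "closed {N+1, N+2, N+3, N+4, N+7} \<or> closed {N+1, N+2, N+6, N+7, N+8} \<or>
        closed {N+2, N+3, N+4, N+5, N+6} \<or> closed {N+4, N+5, N+6, N+7, N+8}"
      using cases that c1 c2 c3 c6 by auto
    moreover have "closed W \<Longrightarrow> W \<subseteq> {N..<N+10} \<Longrightarrow> card W = 5 \<Longrightarrow> \<exists>W. ?good W" for W by blast
    ultimately show ?thesis by (elim disjE) (auto 0 3)
  qed
  have two': "\<exists>W1 W2. ?good W1 \<and> ?good W2 \<and> W1 \<inter> W2 = {}" if "{p, N} \<notin> F'"
  proof -
    have "closed {N+2, N+3, N+6, N+8, N+9} \<and> closed {N, N+1, N+4, N+5, N+7} \<or>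
        closed {N+3, N+4, N+7, N+8, N+9} \<and> closed {N, N+1, N+2, N+5, N+6}"
      using cases that c4 c5 by auto
    then show ?thesis
    proof (elim disjE)
      assume *: "closed {N+2, N+3, N+6, N+8, N+9} \<and> closed {N, N+1, N+4, N+5, N+7}"
      show ?thesis
        by (rule exI[of _ "{N+2, N+3, N+6, N+8, N+9}"], rule exI[of _ "{N, N+1, N+4, N+5, N+7}"])
          (use * in auto)
    next
      assume *: "closed {N+3, N+4, N+7, N+8, N+9} \<and> closed {N, N+1, N+2, N+5, N+6}"
      show ?thesis
        by (rule exI[of _ "{N+3, N+4, N+7, N+8, N+9}"], rule exI[of _ "{N, N+1, N+2, N+5, N+6}"])
          (use * in auto)
    qed
  qed
  have circ_ne: "\<Union>C \<noteq> {}" if "C \<in> avoiding F' D0" for C D0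
    using that by (auto simp: avoiding_def odd_circuits_def circuit_def connected_graph_def)
  have "\<exists>B. finite B \<and> card B = (if {p, q} \<in> F then 1 else 2) \<and> B \<subseteq> avoiding F' ?D'
      \<and> (\<forall>C\<in>B. \<Union>C \<subseteq> {N..<N+10})"
  proof (cases "{p, q} \<in> F")
    case True
    then obtain W C where "?good W" "C \<in> avoiding F' ?D'" "\<Union>C \<subseteq> W"
      using one odd_inside pqF by metis
    then show ?thesis using True by (intro exI[of _ "{C}"]) auto
  next
    case False
    then obtain W1 W2 where W: "?good W1" "?good W2" "W1 \<inter> W2 = {}" using two' pqF by blast
    obtain C1 where C1: "C1 \<in> avoiding F' ?D'" "\<Union>C1 \<subseteq> W1" using odd_inside[OF W(1)] by blast
    obtain C2 where C2: "C2 \<in> avoiding F' ?D'" "\<Union>C2 \<subseteq> W2" using odd_inside[OF W(2)] by blast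
    have "C1 \<noteq> C2" using C1 C2 W(3) circ_ne[OF C1(1)] by blast
    then show ?thesis using False C1 C2 W by (intro exI[of _ "{C1, C2}"]) auto
  qed
  then obtain B where B: "finite B" "card B = (if {p, q} \<in> F then 1 else 2)"
    "B \<subseteq> avoiding F' ?D'" "\<forall>C\<in>B. \<Union>C \<subseteq> {N..<N+10}" by blast
  \<comment> \<open>The two 2-factors agree on old edges other than \<open>{p, q}\<close>, which
    belongs to \<open>D\<close>.\<close>
  have old: "avoiding F D \<subseteq> avoiding F' ?D'"
  proof
    fix C assume C: "C \<in> avoiding F D"
    then have "C \<subseteq> F'" using same D(1) FE by (auto simp: avoiding_def odd_circuits_def)
    moreover have "{p, N} \<notin> C" using C FE not_old(1) by (auto simp: avoiding_def odd_circuits_def)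
    ultimately show "C \<in> avoiding F' ?D'" using C by (auto simp: avoiding_def odd_circuits_def)
  qed
  have "B \<inter> avoiding F D = {}"
  proof (rule ccontr)
    assume "B \<inter> avoiding F D \<noteq> {}"
    then obtain C where C: "C \<in> B" "C \<in> avoiding F D" by blast
    then obtain x where "x \<in> \<Union>C" using circ_ne B(3) by blast
    moreover have "\<Union>C \<subseteq> V" using C(2) simpleF by (auto simp: avoiding_def odd_circuits_def simple_graph_def)
    ultimately show False using C(1) B(4) fresh by fastforce
  qed
  moreover have fin: "finite (avoiding F' ?D')"
    using finite_odd_circuits[OF simpleF' reg] by (simp add: avoiding_def)
  moreover have "finite (avoiding F D)" using fin old by (rule rev_finite_subset)
  ultimately have "card (avoiding F D) + card B = card (avoiding F D \<union> B)"
    using B(1) by (subst card_Un_disjoint) auto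
  also have "\<dots> \<le> card (avoiding F' ?D')" using old B(3) fin by (intro card_mono) auto
  finally show thesis using that[OF two same pqF] B(2) by simp
qed

text \<open>For the upper bound on the oddness. A 2-factor through \<open>{p, q}\<close> is rerouted
  through five vertices of the copy, the other five forming a new pentagon; one that misses
  \<open>{p, q}\<close> gains two pentagons. One representative per new pentagon is added to
  \<open>T\<close>.\<close>

lemma extend_two_factor:
  assumes two: "two_factor V E F"
    and T: "finite T" "\<And>x. x \<in> V \<Longrightarrow> \<exists>t\<in>T. (x, t) \<in> (adj F)\<^sup>*"
  obtains F' T' where "two_factor V' E' F'"
    and "\<And>e. e \<in> E \<Longrightarrow> e \<noteq> {p, q} \<Longrightarrow> e \<in> F' \<longleftrightarrow> e \<in> F"
    and "{p, N} \<in> F' \<longleftrightarrow> {p, q} \<in> F"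
    and "finite T'" "card T' \<le> card T + (if {p, q} \<in> F then 1 else 2)"
    and "\<And>x. x \<in> V' \<Longrightarrow> \<exists>t\<in>T'. (x, t) \<in> (adj F')\<^sup>*"
proof -
  \<comment> \<open>In the first case the path \<open>p, N, N+5, N+6, N+8, N+9, q\<close> and the
    pentagon on \<open>N+1, N+2, N+3, N+4, N+7\<close>; in the second the pentagons on
    \<open>N, N+1, N+4, N+5, N+7\<close> and on \<open>N+2, N+3, N+6, N+8, N+9\<close>.\<close>
  define new where "new = (if {p, q} \<in> F
    then {{p, N}, {q, N+9}, {N, N+5}, {N+1, N+2}, {N+1, N+7}, {N+2, N+3}, {N+3, N+4},
       {N+4, N+7}, {N+5, N+6}, {N+6, N+8}, {N+8, N+9}}
    else {{N, N+1}, {N, N+5}, {N+1, N+7}, {N+2, N+3}, {N+2, N+6}, {N+3, N+9}, {N+4, N+5},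
       {N+4, N+7}, {N+6, N+8}, {N+8, N+9}})"
  define F' where "F' = (F - {{p, q}}) \<union> new"
  define T' where "T' = T \<union> (if {p, q} \<in> F then {N+1} else {N, N+2})"
  have FE: "F \<subseteq> E" and reg: "regular 2 V F" using two by (auto simp: two_factor_def)
  have new_old: "e \<notin> E" if "e \<in> new" for e
  proof -
    have "N \<in> e \<or> N+1 \<in> e \<or> N+2 \<in> e \<or> N+3 \<in> e \<or> N+4 \<in> e \<or> N+5 \<in> e \<or> N+6 \<in> e \<or> N+8 \<in> e \<or> N+9 \<in> e"
      using that by (auto simp: new_def split: if_splits)
    then show ?thesis using edge_below[of e] by fastforce
  qed
  have "new \<subseteq> E'"
    by (cases "{p, q} \<in> F") (simp_all add: new_def insertion_def petersen_minus_edge_def)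
  then have sub: "F' \<subseteq> E'" using FE by (auto simp: F'_def insertion_def)
  have same: "e \<in> F' \<longleftrightarrow> e \<in> F" if "e \<in> E" "e \<noteq> {p, q}" for e
    using that new_old by (auto simp: F'_def)
  have pN: "{p, N} \<in> F' \<longleftrightarrow> {p, q} \<in> F" and qN: "{q, N+9} \<in> F' \<longleftrightarrow> {p, q} \<in> F"
    using not_old FE ends by (auto simp: F'_def new_def doubleton_eq_iff)
  have freshF: "incident F x = {}" if "N \<le> x" for x
    using incident_fresh[OF that] incident_mono[OF FE] by blast
  have "card (incident F' x) = 2" if "N \<le> x" "x < N + 10" for x
    using that ends
    by (rule_tac gadget_vertex_induct[of N x]; cases "{p, q} \<in> F")
      (auto simp: F'_def new_def freshF card_insert_if doubleton_eq_iff)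
  moreover have "card (incident F' x) = 2" if "x \<in> V" for x
    using card_incident_transfer[OF FE sub that] same pN qN reg that
    by (auto simp: regular_def degree_incident)
  ultimately have two': "two_factor V' E' F'"
    using sub by (auto simp: two_factor_def regular_def degree_incident)
  let ?R = "(adj F')\<^sup>*"
  have through: "(N+9, p) \<in> ?R \<and> (N+8, p) \<in> ?R \<and> (N+6, p) \<in> ?R \<and> (N+5, p) \<in> ?R \<and> (N, p) \<in> ?R
      \<and> (q, p) \<in> ?R" if pqF: "{p, q} \<in> F"
  proof -
    have e: "{N, p} \<in> F'" "{N+5, N} \<in> F'" "{N+6, N+5} \<in> F'" "{N+8, N+6} \<in> F'"
        "{N+9, N+8} \<in> F'" "{q, N+9} \<in> F'"
      using pqF by (simp_all add: F'_def new_def doubleton_eq_iff)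
    have r0: "(N, p) \<in> ?R" by (rule adj_step[OF e(1)]) simp
    note r5 = adj_step[OF e(2) r0] and r6 = adj_step[OF e(3) adj_step[OF e(2) r0]]
    note r8 = adj_step[OF e(4) r6]
    note r9 = adj_step[OF e(5) r8]
    show ?thesis using r0 r5 r6 r8 r9 adj_step[OF e(6) r9] by blast
  qed
  \<comment> \<open>A step along \<open>{p, q}\<close> is replaced by the path through the copy, so
    reachability in \<open>F\<close> is inherited by \<open>F'\<close>.\<close>
  have "adj F \<subseteq> ?R"
  proof clarify
    fix x y assume xy: "{x, y} \<in> F"
    show "(x, y) \<in> ?R"
    proof (cases "{x, y} = {p, q}")
      case True
      with through xy adj_rtrancl_sym[of q p F'] show ?thesis by (auto simp: doubleton_eq_iff)
    qed (use xy in \<open>auto simp: F'_def\<close>)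
  qed
  then have lift: "(adj F)\<^sup>* \<subseteq> ?R" by (rule rtrancl_subset_rtrancl)
  have oldT: "\<exists>t\<in>T'. (x, t) \<in> ?R" if "x \<in> V" for x
    using T(2)[OF that] lift by (auto simp: T'_def)
  have newT: "\<exists>t\<in>T'. (x, t) \<in> ?R" if x: "N \<le> x" "x < N + 10" for x
  proof (cases "{p, q} \<in> F")
    case True
    obtain t where t: "t \<in> T'" "(p, t) \<in> ?R" using oldT[OF ends(1)] by blast
    have path: "\<exists>t\<in>T'. (y, t) \<in> ?R" if "(y, p) \<in> ?R" for y
      using t rtrancl_trans[OF that t(2)] by blast
    have N1: "N+1 \<in> T'" using True by (simp add: T'_def)
    have e: "{N+2, N+1} \<in> F'" "{N+7, N+1} \<in> F'" "{N+3, N+2} \<in> F'" "{N+4, N+7} \<in> F'"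
      using True by (simp_all add: F'_def new_def doubleton_eq_iff)
    have r: "(N+2, N+1) \<in> ?R" "(N+7, N+1) \<in> ?R"
      by (rule adj_step[OF e(1)], simp) (rule adj_step[OF e(2)], simp)
    note r' = adj_step[OF e(3) r(1)] adj_step[OF e(4) r(2)]
    show ?thesis
      using x by (rule gadget_vertex_induct) (use r r' N1 path through[OF True] in blast)+
  next
    case False
    then have mem: "N \<in> T'" "N+2 \<in> T'" by (auto simp: T'_def)
    have e: "{N+1, N} \<in> F'" "{N+5, N} \<in> F'" "{N+7, N+1} \<in> F'" "{N+4, N+5} \<in> F'"
        "{N+3, N+2} \<in> F'" "{N+6, N+2} \<in> F'" "{N+9, N+3} \<in> F'" "{N+8, N+6} \<in> F'"
      using False by (simp_all add: F'_def new_def doubleton_eq_iff)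
    have r: "(N+1, N) \<in> ?R" "(N+5, N) \<in> ?R" "(N+3, N+2) \<in> ?R" "(N+6, N+2) \<in> ?R"
      by (rule adj_step[OF e(1)], simp) (rule adj_step[OF e(2)] adj_step[OF e(5)] adj_step[OF e(6)], simp)+
    note r' = adj_step[OF e(3) r(1)] adj_step[OF e(4) r(2)] adj_step[OF e(7) r(3)] adj_step[OF e(8) r(4)]
    show ?thesis
      using x by (rule gadget_vertex_induct) (use r r' mem in blast)+
  qed
  show thesis
  proof (rule that[OF two' same pN])
    show "finite T'" using T by (simp add: T'_def)
    show "card T' \<le> card T + (if {p, q} \<in> F then 1 else 2)"
      unfolding T'_def by (rule order_trans[OF card_Un_le]) simp
    show "\<exists>t\<in>T'. (x, t) \<in> ?R" if "x \<in> V'" for x using that oldT newT by auto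
  qed
qed

end

section \<open>Chains of inserted copies\<close>

text \<open>The invariant of the construction. The edges \<open>d 0, d 1, d 2\<close> are those into which copies are
  inserted, and \<open>w i\<close> is the number of copies inserted into \<open>d i\<close> so far. An unused chain contributes
  \<open>2 * w i\<close> odd circuits and a used one \<open>w i\<close>, whence the sum added to the lower bound. Circuits
  through the \<open>d i\<close> are left out because insertions change their parity. The set \<open>T\<close> bounds the number
  of components of a 2-factor.\<close>

definition chain_state ::
    "nat set \<Rightarrow> nat set set \<Rightarrow> (nat \<Rightarrow> nat set) \<Rightarrow> (nat \<Rightarrow> nat) \<Rightarrow> nat \<Rightarrow> nat \<Rightarrow> bool" where
  "chain_state V E d w c r \<longleftrightarrow>
     cubic V E \<and> card V > 2 \<and>
     (\<exists>f s t. st_ordered V E f s t \<and> (\<forall>i<3. inj_on f (d i) \<and> d i \<noteq> {s, t})) \<and>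
     inj_on d {..<3} \<and> d ` {..<3} \<subseteq> E \<and>
     (\<forall>F. two_factor V E F \<longrightarrow>
        (\<exists>i<3. d i \<notin> F) \<and>
        c \<le> card (avoiding F (d ` {..<3})) + (\<Sum>i<3. if d i \<in> F then w i else 0)) \<and>
     (\<exists>F T. two_factor V E F \<and> d 0 \<in> F \<and> d 1 \<in> F \<and> d 2 \<notin> F \<and>
        finite T \<and> card T \<le> r \<and> (\<forall>x\<in>V. \<exists>t\<in>T. (x, t) \<in> (adj F)\<^sup>*))"

lemma chain_state_insert:
  assumes state: "chain_state V E d w c r" and i: "i < 3"
  shows "\<exists>V' E' d'. chain_state V' E' d' (w(i := Suc (w i))) (c + 2) (r + (if i < 2 then 1 else 2))
    \<and> card V' = card V + 10"
proof -
  from state have cub: "cubic V E" and "card V > 2" and inj: "inj_on d {..<3}"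
    and dE: "d ` {..<3} \<subseteq> E"
    and low: "\<And>F. two_factor V E F \<Longrightarrow> (\<exists>i<3. d i \<notin> F) \<and>
        c \<le> card (avoiding F (d ` {..<3})) + (\<Sum>i<3. if d i \<in> F then w i else 0)"
    by (auto simp: chain_state_def)
  from state obtain f s t where st: "st_ordered V E f s t"
    and f: "\<And>i. i < 3 \<Longrightarrow> inj_on f (d i)" and dst: "\<And>i. i < 3 \<Longrightarrow> d i \<noteq> {s, t}"
    by (auto simp: chain_state_def)
  from state have "\<exists>F T. two_factor V E F \<and> d 0 \<in> F \<and> d 1 \<in> F \<and> d 2 \<notin> F \<and>
      finite T \<and> card T \<le> r \<and> (\<forall>x\<in>V. \<exists>t\<in>T. (x, t) \<in> (adj F)\<^sup>*)"
    unfolding chain_state_def by (elim conjE)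
  then obtain F0 T0 where F0: "two_factor V E F0" "d 0 \<in> F0" "d 1 \<in> F0" "d 2 \<notin> F0"
    and T0: "finite T0" "card T0 \<le> r" "\<forall>x\<in>V. \<exists>t\<in>T0. (x, t) \<in> (adj F0)\<^sup>*"
    by (elim exE conjE)
  note T0' = bspec[OF T0(3)]
  have finV: "finite V" and simple: "simple_graph V E" using cub by (auto simp: cubic_def simple_graph_def)
  have di: "d i \<in> E" using dE i by auto
  then have "card (d i) = 2" using simple by (auto simp: simple_graph_def)
  then obtain a b where ab: "d i = {a, b}" "a \<noteq> b" by (auto simp: card_2_iff)
  then have "f a \<noteq> f b" using f[OF i] by auto
  \<comment> \<open>The ends are named so that \<open>f\<close> increases from \<open>p\<close> to
    \<open>q\<close>, as the extension of the st-numbering requires.\<close>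
  define p q where "p = (if f a < f b then a else b)" and "q = (if f a < f b then b else a)"
  have ends_i: "d i = {p, q}" "p \<noteq> q" "f p < f q"
    using ab \<open>f a \<noteq> f b\<close> by (auto simp: p_def q_def)
  define N where "N = Suc (Max V)"
  have fresh: "x < N" if "x \<in> V" for x using that finV by (simp add: N_def less_Suc_eq_le)
  interpret edge_insertion V E p q N
    by unfold_locales (use cub di ends_i fresh in auto)
  \<comment> \<open>The chain is represented by its edge at \<open>p\<close>: a 2-factor uses
    \<open>{p, N}\<close> exactly when its contraction uses \<open>{p, q}\<close>. The next copy
    goes between \<open>p\<close> and this one.\<close>
  define d' where "d' = d(i := {p, N})"
  define w' where "w' = w(i := Suc (w i))"
  have pN: "{p, N} \<notin> E" by (rule not_old)
  have other: "d j \<in> E" "d j \<noteq> {p, q}" "d' j = d j" if "j < 3" "j \<noteq> i" for j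
    using that dE inj_onD[OF inj, of j i] i ends_i(1) by (auto simp: d'_def)
  have D': "d' ` {..<3} = insert {p, N} (d ` {..<3} - {{p, q}})"
  proof -
    have split: "{..<3} = insert i ({..<3} - {i})" using i by auto
    have "d' ` ({..<3} - {i}) = d ` ({..<3} - {i})" by (rule image_cong) (auto simp: d'_def)
    also have "\<dots> = d ` {..<3} - {{p, q}}"
      using inj_on_image_set_diff[OF inj, of "{..<3}" "{i}"] i ends_i(1) by simp
    finally have "d' ` ({..<3} - {i}) = d ` {..<3} - {{p, q}}" .
    moreover have "d' ` {..<3} = insert (d' i) (d' ` ({..<3} - {i}))" by (subst split) (rule image_insert)
    ultimately show ?thesis by (simp add: d'_def)
  qed
  have "card V' = card V + 10"
    using finV fresh by (subst card_Un_disjoint) (auto dest: fresh)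
  moreover have "chain_state V' E' d' w' (c + 2) (r + (if i < 2 then 1 else 2))"
    unfolding chain_state_def
  proof (intro conjI)
    show "cubic V' E'" by (rule insertion_cubic)
    show "card V' > 2" using \<open>card V > 2\<close> \<open>card V' = card V + 10\<close> by simp
    obtain g where g: "st_ordered V' E' g s t" "\<And>x. x \<in> V \<Longrightarrow> g x = f x" "g p < g N"
      using insertion_st_ordered[OF st ends_i(3)] dst[OF i] ends_i(1) by auto
    have "inj_on g (d' j) \<and> d' j \<noteq> {s, t}" if j: "j < 3" for j
    proof (cases "j = i")
      case True
      have "{s, t} \<in> E" using st by (simp add: st_ordered_def)
      then show ?thesis using True g(3) pN by (auto simp: d'_def)
    next
      case False
      have "d j \<subseteq> V" using other(1)[OF j False] simple by (auto simp: simple_graph_def)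
      then have "inj_on g (d j) = inj_on f (d j)" using g(2) by (intro inj_on_cong) auto
      then show ?thesis using f[OF j] dst[OF j] False by (simp add: d'_def)
    qed
    then show "\<exists>g s t. st_ordered V' E' g s t \<and> (\<forall>i<3. inj_on g (d' i) \<and> d' i \<noteq> {s, t})"
      using g(1) by blast
    show "inj_on d' {..<3}"
      unfolding d'_def using dE pN by (intro inj_on_fun_updI[OF inj]) auto
    show "d' ` {..<3} \<subseteq> E'"
      unfolding D' using dE by (auto simp: insertion_def)
    show "\<forall>F'. two_factor V' E' F' \<longrightarrow> (\<exists>i<3. d' i \<notin> F') \<and>
        c + 2 \<le> card (avoiding F' (d' ` {..<3})) + (\<Sum>i<3. if d' i \<in> F' then w' i else 0)"
    proof (intro allI impI)
      fix F' assume F': "two_factor V' E' F'"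
      have "{p, q} \<in> d ` {..<3}" using i ends_i(1) by auto
      then obtain F where F: "two_factor V E F"
        and same: "\<And>e. e \<in> E \<Longrightarrow> e \<noteq> {p, q} \<Longrightarrow> e \<in> F \<longleftrightarrow> e \<in> F'"
        and new: "{p, q} \<in> F \<longleftrightarrow> {p, N} \<in> F'"
        and count: "card (avoiding F (d ` {..<3})) + (if {p, q} \<in> F then 1 else 2)
           \<le> card (avoiding F' (d' ` {..<3}))"
        using contract_two_factor[OF F' _ dE] unfolding D' by metis
      have mem: "d' j \<in> F' \<longleftrightarrow> d j \<in> F" if "j < 3" for j
        using that same[OF other(1,2)] new ends_i(1) by (cases "j = i") (auto simp: d'_def)
      have "(\<Sum>j<3. if d' j \<in> F' then w' j else 0)
          = (\<Sum>j<3. (if d j \<in> F then w j else 0) + (if j = i then if d i \<in> F then 1 else 0 else 0))"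
        by (rule sum.cong) (auto simp: mem w'_def)
      also have "\<dots> = (\<Sum>j<3. if d j \<in> F then w j else 0) + (if d i \<in> F then 1 else 0)"
        using i by (simp add: sum.distrib)
      finally show "(\<exists>i<3. d' i \<notin> F') \<and>
        c + 2 \<le> card (avoiding F' (d' ` {..<3})) + (\<Sum>i<3. if d' i \<in> F' then w' i else 0)"
        using low[OF F] mem count ends_i(1) by (auto split: if_splits)
    qed
    obtain F' T' where F': "two_factor V' E' F'"
      and same: "\<And>e. e \<in> E \<Longrightarrow> e \<noteq> {p, q} \<Longrightarrow> e \<in> F' \<longleftrightarrow> e \<in> F0"
      and new: "{p, N} \<in> F' \<longleftrightarrow> {p, q} \<in> F0"
      and T': "finite T'" "card T' \<le> card T0 + (if {p, q} \<in> F0 then 1 else 2)"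
        "\<And>x. x \<in> V' \<Longrightarrow> \<exists>t\<in>T'. (x, t) \<in> (adj F')\<^sup>*"
      by (rule extend_two_factor[OF F0(1) T0(1) T0']) (assumption, rule that)
    have mem: "d' j \<in> F' \<longleftrightarrow> d j \<in> F0" if "j < 3" for j
      using that same[OF other(1,2)] new ends_i(1) by (cases "j = i") (auto simp: d'_def)
    have "{p, q} \<in> F0" if "i < 2" using that F0(2,3) ends_i(1) by (auto simp: less_2_cases_iff)
    then have "card T' \<le> r + (if i < 2 then 1 else 2)" using T'(2) T0(2) by (auto split: if_splits)
    then show "\<exists>F T. two_factor V' E' F \<and> d' 0 \<in> F \<and> d' 1 \<in> F \<and> d' 2 \<notin> F \<and> finite T \<and>
        card T \<le> r + (if i < 2 then 1 else 2) \<and> (\<forall>x\<in>V'. \<exists>t\<in>T. (x, t) \<in> (adj F)\<^sup>*)"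
      using F' F0 T' mem by (intro exI[of _ F'] exI[of _ T']) simp
  qed
  ultimately show ?thesis unfolding w'_def by blast
qed

text \<open>Only the three weights below 3 matter; this identifies three successive updates with a
  uniform increment.\<close>

lemma chain_state_cong:
  assumes "chain_state V E d w c r" "\<And>i. i < 3 \<Longrightarrow> w i = w' i"
  shows "chain_state V E d w' c r"
proof -
  have "(\<Sum>i<3. if d i \<in> F then w i else 0) = (\<Sum>i<3. if d i \<in> F then w' i else 0)" for F
    by (rule sum.cong) (simp_all add: assms(2))
  then have "chain_state V E d w c r = chain_state V E d w' c r" by (simp only: chain_state_def)
  then show ?thesis using assms(1) by simp
qed

text \<open>A round of insertions into the three edges raises \<open>c\<close> by 2 + 2 + 2 and
  \<open>r\<close> by 1 + 1 + 2, at the cost of 30 vertices.\<close>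

lemma chain_state_insert_everywhere:
  assumes "chain_state V E d w c r"
  shows "\<exists>V' E' d'. chain_state V' E' d' (\<lambda>i. w i + k) (c + 6 * k) (r + 4 * k)
    \<and> card V' = card V + 30 * k"
proof (induction k)
  case (Suc k)
  then obtain V0 E0 d0 where 0: "chain_state V0 E0 d0 (\<lambda>i. w i + k) (c + 6 * k) (r + 4 * k)"
    "card V0 = card V + 30 * k" by blast
  let ?w1 = "(\<lambda>i. w i + k)(0 := Suc (w 0 + k))"
  let ?w2 = "?w1(1 := Suc (w 1 + k))" let ?w3 = "?w2(2 := Suc (w 2 + k))"
  obtain V1 E1 d1 where 1: "chain_state V1 E1 d1 ?w1 (c + 6 * k + 2) (r + 4 * k + 1)"
    "card V1 = card V0 + 10"
    using chain_state_insert[OF 0(1), of 0] by auto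
  have "\<exists>V2 E2 d2. chain_state V2 E2 d2 ?w2 (c + 6 * k + 2 + 2) (r + 4 * k + 1 + 1)
      \<and> card V2 = card V1 + 10"
    using chain_state_insert[OF 1(1), of 1] by simp
  then obtain V2 E2 d2 where 2: "chain_state V2 E2 d2 ?w2 (c + 6 * k + 2 + 2) (r + 4 * k + 1 + 1)"
    "card V2 = card V1 + 10" by blast
  have "\<exists>V3 E3 d3. chain_state V3 E3 d3 ?w3 (c + 6 * k + 2 + 2 + 2) (r + 4 * k + 1 + 1 + 2)
      \<and> card V3 = card V2 + 10"
    using chain_state_insert[OF 2(1), of 2] by simp
  then obtain V3 E3 d3 where
    3: "chain_state V3 E3 d3 ?w3 (c + 6 * k + 2 + 2 + 2) (r + 4 * k + 1 + 1 + 2)"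
    "card V3 = card V2 + 10" by blast
  have "chain_state V3 E3 d3 (\<lambda>i. w i + Suc k) (c + 6 * k + 2 + 2 + 2) (r + 4 * k + 1 + 1 + 2)"
    by (rule chain_state_cong[OF 3(1)]) (auto simp: eval_nat_numeral less_Suc_eq)
  moreover have eq: "c + 6 * k + 2 + 2 + 2 = c + 6 * Suc k" "r + 4 * k + 1 + 1 + 2 = r + 4 * Suc k"
    by simp_all
  ultimately have "chain_state V3 E3 d3 (\<lambda>i. w i + Suc k) (c + 6 * Suc k) (r + 4 * Suc k)"
    by (simp only: eq)
  then show ?case using 0 1 2 3 by (intro exI[of _ V3] exI[of _ E3] exI[of _ d3]) simp
qed (use assms in auto)

lemma chain_state_snark:
  assumes state: "chain_state V E d w c r" and "r \<le> \<omega>" and "even \<omega>" "\<omega> \<ge> 2"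
    and weights: "\<And>i. i < 3 \<Longrightarrow> \<omega> + (\<Sum>j\<in>{..<3} - {i}. w j) \<le> c + 1"
  shows "snark V E \<and> oddness V E = \<omega>"
proof -
  from state have cub: "cubic V E" and "card V > 2"
    and low: "\<And>F. two_factor V E F \<Longrightarrow> (\<exists>i<3. d i \<notin> F) \<and>
        c \<le> card (avoiding F (d ` {..<3})) + (\<Sum>i<3. if d i \<in> F then w i else 0)"
    by (auto simp: chain_state_def)
  have simple: "simple_graph V E" using cub by (simp add: cubic_def)
  have evenV: "even (card V)"
  proof -
    have "2 * card E = 3 * card V" using handshake[OF simple] cub by (simp add: cubic_def)
    then show ?thesis by presburger
  qed
  have F_props: "simple_graph V F" "regular 2 V F" if "two_factor V E F" for F
    using that simple_graph_subset[OF simple] by (auto simp: two_factor_def)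
  have lower: "\<omega> \<le> card (odd_circuits F)" if F: "two_factor V E F" for F
  proof -
    obtain i where i: "i < 3" "d i \<notin> F" using low[OF F] by blast
    have "(\<Sum>j<3. if d j \<in> F then w j else 0) = (\<Sum>j\<in>{..<3} - {i}. if d j \<in> F then w j else 0)"
      using i by (subst sum.remove[of _ i]) auto
    also have "\<dots> \<le> (\<Sum>j\<in>{..<3} - {i}. w j)" by (rule sum_mono) auto
    finally have "\<omega> \<le> card (avoiding F (d ` {..<3})) + 1"
      using low[OF F] weights[OF i(1)] by linarith
    also have "card (avoiding F (d ` {..<3})) \<le> card (odd_circuits F)"
      using finite_odd_circuits[OF F_props[OF F]] by (intro card_mono) (auto simp: avoiding_def)
    finally have "\<omega> \<le> card (odd_circuits F) + 1" by simp
    moreover have "even (card (odd_circuits F))"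
      using even_card_odd_circuits[OF F_props[OF F]] evenV by simp
    ultimately show ?thesis using \<open>even \<omega>\<close> by presburger
  qed
  from state have "\<exists>F T. two_factor V E F \<and> d 0 \<in> F \<and> d 1 \<in> F \<and> d 2 \<notin> F \<and>
      finite T \<and> card T \<le> r \<and> (\<forall>x\<in>V. \<exists>t\<in>T. (x, t) \<in> (adj F)\<^sup>*)"
    unfolding chain_state_def by (elim conjE)
  then obtain F T where F: "two_factor V E F" and T: "finite T" "card T \<le> r"
    "\<forall>x\<in>V. \<exists>t\<in>T. (x, t) \<in> (adj F)\<^sup>*"
    by (elim exE conjE)
  have "card (odd_circuits F) \<le> card T"
    using card_odd_circuits_le[OF F_props[OF F] T(1)] T(3) by blast
  then have attained: "card (odd_circuits F) = \<omega>"
    using lower[OF F] T(2) \<open>r \<le> \<omega>\<close> by simp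
  have "finite {F. two_factor V E F}"
    by (rule finite_subset[of _ "Pow E"])
      (use simple_graph_finite_edges[OF simple] in \<open>auto simp: two_factor_def\<close>)
  then have "finite {card (odd_circuits F) | F. two_factor V E F}" by simp
  then have "oddness V E = \<omega>"
    unfolding oddness_def using lower F attained by (intro Min_eqI) auto
  moreover have "k_connected 2 V E"
    using state st_ordered_2_connected[OF simple \<open>card V > 2\<close>] by (auto simp: chain_state_def)
  moreover have "\<nexists>c. proper_edge_colouring 3 E c"
  proof
    assume "\<exists>c. proper_edge_colouring 3 E c"
    then obtain F where F: "two_factor V E F" "odd_circuits F = {}"
      using three_colouring_two_factor[OF cub] by blast
    then show False using lower[OF F(1)] \<open>\<omega> \<ge> 2\<close> by simp
  qed
  ultimately show ?thesis using cub by (simp add: snark_def)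
qed

section \<open>The initial graphs\<close>

text \<open>The set \<open>S\<close> is a Petersen graph without its vertex \<open>N + 7\<close>,
  and \<open>a\<close>, \<open>b\<close>, \<open>c\<close> are the edges leaving it. If none of them
  is used, \<open>S\<close> is an odd closed set. Otherwise exactly two are, the 2-factor completes
  at the missing vertex to one of the Petersen graph, and its pentagon away from that vertex lies in
  \<open>S\<close>. Prescribing only the incidences at \<open>S\<close> lets the lemma apply to both
  initial graphs.\<close>

lemma odd_circuit_in_petersen_minus_vertex:
  assumes cub: "cubic V E" and two: "two_factor V E F"
    and S: "S = {N, N+1, N+2, N+3, N+4, N+5, N+6, N+8, N+9 :: nat}" "S \<subseteq> V"
    and inc:
      "incident E N = {{N, N+1}, {N, N+5}, {N, N+9}}"
      "incident E (N+1) = {{N, N+1}, {N+1, N+2}, a}"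
      "incident E (N+2) = {{N+1, N+2}, {N+2, N+3}, {N+2, N+6}}"
      "incident E (N+3) = {{N+2, N+3}, {N+3, N+4}, {N+3, N+9}}"
      "incident E (N+4) = {{N+3, N+4}, {N+4, N+5}, b}"
      "incident E (N+5) = {{N, N+5}, {N+4, N+5}, {N+5, N+6}}"
      "incident E (N+6) = {{N+2, N+6}, {N+5, N+6}, {N+6, N+8}}"
      "incident E (N+8) = {{N+6, N+8}, c, {N+8, N+9}}"
      "incident E (N+9) = {{N, N+9}, {N+3, N+9}, {N+8, N+9}}"
  shows "\<not> (a \<in> F \<and> b \<in> F \<and> c \<in> F) \<and> (\<exists>C \<in> odd_circuits F. \<Union>C \<subseteq> S)"
proof -
  have sub: "F \<subseteq> E" and reg: "regular 2 V F" using two by (auto simp: two_factor_def)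
  have simpleF: "simple_graph V F"
    using cub sub simple_graph_subset by (auto simp: cubic_def)
  have vertex: "two_of_three (e1 \<in> F) (e2 \<in> F) (e3 \<in> F)"
    if "x \<in> S" "incident E x = {e1, e2, e3}" for x e1 e2 e3
  proof -
    have "card (incident F x) = 2" "card (incident E x) = 3"
      using that(1) reg cub S(2) by (auto simp: regular_def degree_incident cubic_def)
    then show ?thesis using two_factor_at_cubic_vertex[OF sub _ that(2)] by blast
  qed
  have cases: "(a \<notin> F \<and> b \<notin> F \<and> c \<notin> F) \<or>
    two_of_three (a \<in> F) (b \<in> F) (c \<in> F) \<and>
    ({N, N+1} \<notin> F \<and> {N+2, N+6} \<notin> F \<and> {N+3, N+9} \<notin> F \<and> {N+4, N+5} \<notin> F \<and> c \<notin> F \<or>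
     {N, N+1} \<notin> F \<and> {N+2, N+3} \<notin> F \<and> b \<notin> F \<and> {N+5, N+6} \<notin> F \<and> {N+8, N+9} \<notin> F \<or>
     {N, N+5} \<notin> F \<and> {N+1, N+2} \<notin> F \<and> {N+3, N+9} \<notin> F \<and> b \<notin> F \<and> {N+6, N+8} \<notin> F \<or>
     {N, N+9} \<notin> F \<and> {N+1, N+2} \<notin> F \<and> {N+3, N+4} \<notin> F \<and> {N+5, N+6} \<notin> F \<and> c \<notin> F \<or>
     {N, N+9} \<notin> F \<and> a \<notin> F \<and> {N+2, N+3} \<notin> F \<and> {N+4, N+5} \<notin> F \<and> {N+6, N+8} \<notin> F \<or>
     {N, N+5} \<notin> F \<and> a \<notin> F \<and> {N+2, N+6} \<notin> F \<and> {N+3, N+4} \<notin> F \<and> {N+8, N+9} \<notin> F)"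
    by (rule petersen_minus_vertex_cases[OF vertex[OF _ inc(1)] vertex[OF _ inc(2)] vertex[OF _ inc(3)]
      vertex[OF _ inc(4)] vertex[OF _ inc(5)] vertex[OF _ inc(6)] vertex[OF _ inc(7)]
      vertex[OF _ inc(8)] vertex[OF _ inc(9)]]) (simp_all add: S(1))
  have inc': "e \<in> incident E x \<and> e \<in> F" if "e \<in> incident F x" for e x
    using that sub by (auto simp: incident_def)
  define closed where "closed W \<longleftrightarrow> (\<forall>x\<in>W. \<forall>e\<in>incident F x. e \<subseteq> W)" for W
  note ig = inc[simplified]
  have "\<exists>W. closed W \<and> W \<subseteq> S \<and> odd (card W)"
    using cases
  proof (elim disjE conjE)
    assume "a \<notin> F" "b \<notin> F" "c \<notin> F"
    then have "closed S" by (auto simp: S(1) closed_def ig dest!: inc')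
    then show ?thesis by (intro exI[of _ S]) (simp add: S(1))
  next
    assume "{N, N+1} \<notin> F" "{N+2, N+6} \<notin> F" "{N+3, N+9} \<notin> F" "{N+4, N+5} \<notin> F" "c \<notin> F"
    then have "closed {N, N+5, N+6, N+8, N+9}" by (auto simp: closed_def ig dest!: inc')
    then show ?thesis by (intro exI[of _ "{N, N+5, N+6, N+8, N+9}"]) (simp add: S(1))
  next
    assume "{N, N+1} \<notin> F" "{N+2, N+3} \<notin> F" "b \<notin> F" "{N+5, N+6} \<notin> F" "{N+8, N+9} \<notin> F"
    then have "closed {N, N+3, N+4, N+5, N+9}" by (auto simp: closed_def ig dest!: inc')
    then show ?thesis by (intro exI[of _ "{N, N+3, N+4, N+5, N+9}"]) (simp add: S(1))
  next
    assume "{N, N+5} \<notin> F" "{N+1, N+2} \<notin> F" "{N+3, N+9} \<notin> F" "b \<notin> F" "{N+6, N+8} \<notin> F"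
    then have "closed {N+2, N+3, N+4, N+5, N+6}" by (auto simp: closed_def ig dest!: inc')
    then show ?thesis by (intro exI[of _ "{N+2, N+3, N+4, N+5, N+6}"]) (simp add: S(1))
  next
    assume "{N, N+9} \<notin> F" "{N+1, N+2} \<notin> F" "{N+3, N+4} \<notin> F" "{N+5, N+6} \<notin> F" "c \<notin> F"
    then have "closed {N+2, N+3, N+6, N+8, N+9}" by (auto simp: closed_def ig dest!: inc')
    then show ?thesis by (intro exI[of _ "{N+2, N+3, N+6, N+8, N+9}"]) (simp add: S(1))
  next
    assume "{N, N+9} \<notin> F" "a \<notin> F" "{N+2, N+3} \<notin> F" "{N+4, N+5} \<notin> F" "{N+6, N+8} \<notin> F"
    then have "closed {N, N+1, N+2, N+5, N+6}" by (auto simp: closed_def ig dest!: inc')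
    then show ?thesis by (intro exI[of _ "{N, N+1, N+2, N+5, N+6}"]) (simp add: S(1))
  next
    assume "{N, N+5} \<notin> F" "a \<notin> F" "{N+2, N+6} \<notin> F" "{N+3, N+4} \<notin> F" "{N+8, N+9} \<notin> F"
    then have "closed {N, N+1, N+2, N+3, N+9}" by (auto simp: closed_def ig dest!: inc')
    then show ?thesis by (intro exI[of _ "{N, N+1, N+2, N+3, N+9}"]) (simp add: S(1))
  qed
  then obtain W where W: "closed W" "W \<subseteq> S" "odd (card W)" by blast
  have "\<exists>C \<in> odd_circuits F. \<Union>C \<subseteq> W"
    using W S(2) by (intro odd_closed_set_contains_odd_circuit[OF simpleF reg]) (auto simp: closed_def)
  then have "\<exists>C \<in> odd_circuits F. \<Union>C \<subseteq> S" using W(2) by blast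
  moreover have "\<not> (a \<in> F \<and> b \<in> F \<and> c \<in> F)"
    using cases by (auto simp: two_of_three_def)
  ultimately show ?thesis by blast
qed

section \<open>The Petersen graph and the double Petersen graph as initial states\<close>

definition petersen_vertices :: "nat set" where
  "petersen_vertices = {0, 1, 2, 3, 4, 5, 6, 7, 8, 9}"

definition petersen_edges :: "nat set set" where
  "petersen_edges =
     {{0, 1}, {0, 5}, {0, 9}, {1, 2}, {1, 7}, {2, 3}, {2, 6}, {3, 4}, {3, 9}, {4, 5}, {4, 7},
      {5, 6}, {6, 8}, {7, 8}, {8, 9}}"

definition three_edges :: "'a set \<Rightarrow> 'a set \<Rightarrow> 'a set \<Rightarrow> nat \<Rightarrow> 'a set" where
  "three_edges a b c = (\<lambda>i. if i = 0 then a else if i = 1 then b else c)"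

lemma three_edges_simps [simp]:
  "three_edges a b c 0 = a" "three_edges a b c (Suc 0) = b" "three_edges a b c 2 = c"
  "three_edges a b c ` {..<3} = {a, b, c}"
  "inj_on (three_edges a b c) {..<3} \<longleftrightarrow> a \<noteq> b \<and> a \<noteq> c \<and> b \<noteq> c"
  by (auto simp: three_edges_def eval_nat_numeral lessThan_Suc)

lemma all_less_3: "(\<forall>i<3. P i) \<longleftrightarrow> P 0 \<and> P (Suc 0) \<and> P (2::nat)"
  by (auto simp: eval_nat_numeral less_Suc_eq)

lemma ex_less_3: "(\<exists>i<3. P i) \<longleftrightarrow> P 0 \<or> P (Suc 0) \<or> P (2::nat)"
  using all_less_3[of "\<lambda>i. \<not> P i"] by blast

lemma petersen_cubic: "cubic petersen_vertices petersen_edges"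
  by (simp add: cubic_def simple_graph_def regular_def degree_incident petersen_vertices_def
      petersen_edges_def card_insert_if doubleton_eq_iff)

lemma ball_Diff_singleton: "(\<forall>x\<in>A - {a}. P x) \<longleftrightarrow> (\<forall>x\<in>A. x \<noteq> a \<longrightarrow> P x)"
  by auto

lemma petersen_st_ordered: "st_ordered petersen_vertices petersen_edges real 0 9"
  by (simp add: st_ordered_def petersen_vertices_def petersen_edges_def doubleton_eq_iff
      conj_disj_distribR ex_disj_distrib ball_Diff_singleton)

lemma petersen_odd_circuit:
  assumes "two_factor petersen_vertices petersen_edges F"
  shows "\<not> ({1, 7} \<in> F \<and> {4, 7} \<in> F \<and> {7, 8} \<in> F) \<and>
    (\<exists>C \<in> odd_circuits F. \<Union>C \<subseteq> {0, 1, 2, 3, 4, 5, 6, 8, 9})"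
  by (rule odd_circuit_in_petersen_minus_vertex[OF petersen_cubic assms, of _ 0])
    (auto simp: petersen_vertices_def petersen_edges_def)

text \<open>The chain edges are those at vertex 7, of which a 2-factor omits one. Only the pentagon
  away from 7 avoids them, whence \<open>c = 1\<close>, while \<open>r = 2\<close> counts both
  pentagons.\<close>

lemma petersen_state:
  "chain_state petersen_vertices petersen_edges (three_edges {1, 7} {4, 7} {7, 8}) (\<lambda>_. 0) 1 2"
proof -
  let ?V = petersen_vertices and ?E = petersen_edges and ?D = "{{1, 7}, {4, 7}, {7, 8 :: nat}}"
  have low: "1 \<le> card (avoiding F ?D)" if F: "two_factor ?V ?E F" for F
  proof -
    obtain C where C: "C \<in> odd_circuits F" "\<Union>C \<subseteq> {0, 1, 2, 3, 4, 5, 6, 8, 9}"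
      using petersen_odd_circuit[OF F] by blast
    then have "C \<inter> ?D = {}" by auto
    then have "C \<in> avoiding F ?D" using C(1) by (simp add: avoiding_def)
    moreover have "simple_graph ?V F" "regular 2 ?V F"
      using F petersen_cubic simple_graph_subset by (auto simp: two_factor_def cubic_def)
    from finite_odd_circuits[OF this] have "finite (avoiding F ?D)" by (simp add: avoiding_def)
    ultimately show ?thesis by (auto simp: Suc_le_eq card_gt_0_iff)
  qed
  \<comment> \<open>The pentagons on 0, 5, 6, 8, 9 and on 1, 2, 3, 4, 7.\<close>
  define F :: "nat set set" where
    "F = {{0, 5}, {0, 9}, {1, 2}, {1, 7}, {2, 3}, {3, 4}, {4, 7}, {5, 6}, {6, 8}, {8, 9}}"
  let ?R = "(adj F)\<^sup>*"
  have two: "two_factor ?V ?E F"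
    by (simp add: two_factor_def regular_def degree_incident petersen_vertices_def
      petersen_edges_def card_insert_if doubleton_eq_iff F_def)
  have r: "(5, 0) \<in> ?R" "(9, 0) \<in> ?R" "(2, 1) \<in> ?R" "(7, 1) \<in> ?R"
    by (rule adj_step[OF _ rtrancl_refl], simp add: F_def doubleton_eq_iff)+
  have r': "(6, 0) \<in> ?R" "(8, 0) \<in> ?R" "(3, 1) \<in> ?R" "(4, 1) \<in> ?R"
    by (rule adj_step[OF _ r(1)] adj_step[OF _ r(2)] adj_step[OF _ r(3)] adj_step[OF _ r(4)],
      simp add: F_def doubleton_eq_iff)+
  have reach: "\<forall>x\<in>?V. \<exists>t\<in>{0, 1}. (x, t) \<in> ?R"
    unfolding petersen_vertices_def using r r' by blast
  have mem: "{1, 7} \<in> F" "{4, 7} \<in> F" "{7, 8} \<notin> F"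
    by (simp_all add: F_def doubleton_eq_iff)
  have "\<exists>f s t. st_ordered ?V ?E f s t \<and>
      (\<forall>i<3. inj_on f (three_edges {1, 7} {4, 7} {7, 8} i) \<and> three_edges {1, 7} {4, 7} {7, 8} i \<noteq> {s, t})"
    by (intro exI[of _ real] exI[of _ 0] exI[of _ 9] conjI petersen_st_ordered)
      (simp add: all_less_3 doubleton_eq_iff)
  moreover have "\<exists>F T. two_factor ?V ?E F \<and> {1, 7} \<in> F \<and> {4, 7} \<in> F \<and> {7, 8} \<notin> F \<and>
      finite T \<and> card T \<le> 2 \<and> (\<forall>x\<in>?V. \<exists>t\<in>T. (x, t) \<in> (adj F)\<^sup>*)"
    using two mem reach by (intro exI[of _ F] exI[of _ "{0, 1}"]) simp
  moreover have "card ?V > 2" by (simp add: petersen_vertices_def)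
  moreover have "{{1, 7}, {4, 7}, {7, 8}} \<subseteq> ?E" by (simp add: petersen_edges_def)
  moreover have "(\<exists>i<3. three_edges {1, 7} {4, 7} {7, 8} i \<notin> F)" if "two_factor ?V ?E F" for F
    using petersen_odd_circuit[OF that] by (auto simp: ex_less_3)
  ultimately show ?thesis
    unfolding chain_state_def using petersen_cubic low by (simp add: doubleton_eq_iff)
qed

text \<open>Two copies of the Petersen graph minus its vertex 7, corresponding vertices being \<open>i\<close> and
  \<open>10 + i\<close>, with the neighbours of the missing vertices joined.\<close>

definition double_petersen_vertices :: "nat set" where
  "double_petersen_vertices = {0, 1, 2, 3, 4, 5, 6, 8, 9, 10, 11, 12, 13, 14, 15, 16, 18, 19}"

definition double_petersen_edges :: "nat set set" where
  "double_petersen_edges =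
     {{0, 1}, {0, 5}, {0, 9}, {1, 2}, {2, 3}, {2, 6}, {3, 4}, {3, 9}, {4, 5}, {5, 6}, {6, 8}, {8, 9},
      {1, 11}, {4, 14}, {8, 18},
      {10, 11}, {10, 15}, {10, 19}, {11, 12}, {12, 13}, {12, 16}, {13, 14}, {13, 19}, {14, 15},
      {15, 16}, {16, 18}, {18, 19}}"

lemma double_petersen_cubic: "cubic double_petersen_vertices double_petersen_edges"
  by (simp add: cubic_def simple_graph_def regular_def degree_incident double_petersen_vertices_def
      double_petersen_edges_def card_insert_if doubleton_eq_iff)

text \<open>The entries at the non-vertices 7 and 17 are dummies.\<close>

definition double_petersen_order :: "nat \<Rightarrow> real" where
  "double_petersen_order x =
     [0, 1, 2, 4, 5, 7, 13, 0, 16, 17, 10, 3, 9, 12, 6, 8, 11, 0, 15, 14] ! x"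

lemma double_petersen_st_ordered:
  "st_ordered double_petersen_vertices double_petersen_edges double_petersen_order 0 9"
  by (simp add: st_ordered_def double_petersen_vertices_def double_petersen_edges_def
      doubleton_eq_iff conj_disj_distribR ex_disj_distrib ball_Diff_singleton double_petersen_order_def)

lemma double_petersen_odd_circuits:
  assumes F: "two_factor double_petersen_vertices double_petersen_edges F"
  shows "\<not> ({1, 11} \<in> F \<and> {4, 14} \<in> F \<and> {8, 18} \<in> F)"
    and "\<exists>C \<in> odd_circuits F. \<Union>C \<subseteq> {0, 1, 2, 3, 4, 5, 6, 8, 9}"
    and "\<exists>C \<in> odd_circuits F. \<Union>C \<subseteq> {10, 11, 12, 13, 14, 15, 16, 18, 19}"
proof -
  have "\<not> ({1, 11} \<in> F \<and> {4, 14} \<in> F \<and> {8, 18} \<in> F) \<and>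
    (\<exists>C \<in> odd_circuits F. \<Union>C \<subseteq> {0, 1, 2, 3, 4, 5, 6, 8, 9})"
    by (rule odd_circuit_in_petersen_minus_vertex[OF double_petersen_cubic F, of _ 0])
      (auto simp: double_petersen_vertices_def double_petersen_edges_def)
  moreover have "\<not> ({1, 11} \<in> F \<and> {4, 14} \<in> F \<and> {8, 18} \<in> F) \<and>
    (\<exists>C \<in> odd_circuits F. \<Union>C \<subseteq> {10, 11, 12, 13, 14, 15, 16, 18, 19})"
    by (rule odd_circuit_in_petersen_minus_vertex[OF double_petersen_cubic F, of _ 10])
      (auto simp: double_petersen_vertices_def double_petersen_edges_def)
  ultimately show "\<not> ({1, 11} \<in> F \<and> {4, 14} \<in> F \<and> {8, 18} \<in> F)"
    "\<exists>C \<in> odd_circuits F. \<Union>C \<subseteq> {0, 1, 2, 3, 4, 5, 6, 8, 9}"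
    "\<exists>C \<in> odd_circuits F. \<Union>C \<subseteq> {10, 11, 12, 13, 14, 15, 16, 18, 19}"
    by blast+
qed

text \<open>Each half contains an odd circuit away from the three connecting edges, whence
  \<open>c = 2\<close>.\<close>

lemma double_petersen_state:
  "chain_state double_petersen_vertices double_petersen_edges
     (three_edges {1, 11} {4, 14} {8, 18}) (\<lambda>_. 0) 2 3"
proof -
  let ?V = double_petersen_vertices and ?E = double_petersen_edges
  let ?D = "{{1, 11}, {4, 14}, {8, 18 :: nat}}"
  have low: "2 \<le> card (avoiding F ?D)" if F: "two_factor ?V ?E F" for F
  proof -
    obtain C1 where C1: "C1 \<in> odd_circuits F" "\<Union>C1 \<subseteq> {0, 1, 2, 3, 4, 5, 6, 8, 9}"
      using double_petersen_odd_circuits(2)[OF F] by blast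
    obtain C2 where C2: "C2 \<in> odd_circuits F" "\<Union>C2 \<subseteq> {10, 11, 12, 13, 14, 15, 16, 18, 19}"
      using double_petersen_odd_circuits(3)[OF F] by blast
    have "C1 \<inter> ?D = {}" using C1(2) by auto
    moreover have "C2 \<inter> ?D = {}" using C2(2) by auto
    ultimately have sub: "{C1, C2} \<subseteq> avoiding F ?D"
      using C1(1) C2(1) by (simp add: avoiding_def)
    have "\<Union>C1 \<noteq> {}" using C1(1) circuit_nonempty by (auto simp: odd_circuits_def)
    moreover have "\<Union>C1 \<inter> \<Union>C2 = {}" using C1(2) C2(2) by fastforce
    ultimately have "C1 \<noteq> C2" by auto
    moreover have "simple_graph ?V F" "regular 2 ?V F"
      using F double_petersen_cubic simple_graph_subset by (auto simp: two_factor_def cubic_def)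
    from finite_odd_circuits[OF this] have "finite (avoiding F ?D)" by (simp add: avoiding_def)
    ultimately show ?thesis using card_mono[OF _ sub] by simp
  qed
  \<comment> \<open>A pentagon in each half and a circuit of length 8 through \<open>{1, 11}\<close>
    and \<open>{4, 14}\<close>. An insertion into \<open>{1, 11}\<close> lengthens the latter by 5
    and adds a pentagon, which makes four odd circuits.\<close>
  define F :: "nat set set" where
    "F = {{0, 5}, {0, 9}, {5, 6}, {6, 8}, {8, 9}, {1, 2}, {2, 3}, {3, 4}, {1, 11}, {4, 14},
      {11, 12}, {12, 13}, {13, 14}, {10, 15}, {10, 19}, {15, 16}, {16, 18}, {18, 19}}"
  let ?R = "(adj F)\<^sup>*"
  have two: "two_factor ?V ?E F"
    by (simp add: two_factor_def regular_def degree_incident double_petersen_vertices_def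
      double_petersen_edges_def card_insert_if doubleton_eq_iff F_def)
  have r: "(5, 0) \<in> ?R" "(9, 0) \<in> ?R" "(2, 1) \<in> ?R" "(11, 1) \<in> ?R" "(15, 10) \<in> ?R" "(19, 10) \<in> ?R"
    by (rule adj_step[OF _ rtrancl_refl], simp add: F_def doubleton_eq_iff)+
  have r': "(6, 0) \<in> ?R" "(8, 0) \<in> ?R" "(3, 1) \<in> ?R" "(12, 1) \<in> ?R" "(16, 10) \<in> ?R" "(18, 10) \<in> ?R"
    by (rule adj_step[OF _ r(1)] adj_step[OF _ r(2)] adj_step[OF _ r(3)] adj_step[OF _ r(4)]
      adj_step[OF _ r(5)] adj_step[OF _ r(6)], simp add: F_def doubleton_eq_iff)+
  have r'': "(4, 1) \<in> ?R" "(13, 1) \<in> ?R"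
    by (rule adj_step[OF _ r'(3)] adj_step[OF _ r'(4)], simp add: F_def doubleton_eq_iff)+
  have "(14, 1) \<in> ?R"
    by (rule adj_step[OF _ r''(2)], simp add: F_def doubleton_eq_iff)
  then have reach: "\<forall>x\<in>?V. \<exists>t\<in>{0, 1, 10}. (x, t) \<in> ?R"
    unfolding double_petersen_vertices_def using r r' r'' by blast
  have mem: "{1, 11} \<in> F" "{4, 14} \<in> F" "{8, 18} \<notin> F"
    by (simp_all add: F_def doubleton_eq_iff)
  have "\<exists>f s t. st_ordered ?V ?E f s t \<and>
      (\<forall>i<3. inj_on f (three_edges {1, 11} {4, 14} {8, 18} i) \<and>
        three_edges {1, 11} {4, 14} {8, 18} i \<noteq> {s, t})"
    by (intro exI[of _ double_petersen_order] exI[of _ 0] exI[of _ 9] conjI double_petersen_st_ordered)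
      (simp add: all_less_3 doubleton_eq_iff double_petersen_order_def)
  moreover have "\<exists>F T. two_factor ?V ?E F \<and> {1, 11} \<in> F \<and> {4, 14} \<in> F \<and> {8, 18} \<notin> F \<and>
      finite T \<and> card T \<le> 3 \<and> (\<forall>x\<in>?V. \<exists>t\<in>T. (x, t) \<in> (adj F)\<^sup>*)"
    using two mem reach by (intro exI[of _ F] exI[of _ "{0, 1, 10}"]) simp
  moreover have "card ?V > 2" by (simp add: double_petersen_vertices_def)
  moreover have "{{1, 11}, {4, 14}, {8, 18}} \<subseteq> ?E" by (simp add: double_petersen_edges_def)
  moreover have "(\<exists>i<3. three_edges {1, 11} {4, 14} {8, 18} i \<notin> F)" if "two_factor ?V ?E F" for F
    using double_petersen_odd_circuits(1)[OF that] by (auto simp: ex_less_3)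
  ultimately show ?thesis
    unfolding chain_state_def using double_petersen_cubic low by (simp add: doubleton_eq_iff)
qed

section \<open>The two residue classes of even numbers modulo 4\<close>

theorem theorem3:
  fixes \<omega> :: nat
  assumes "even \<omega>" and "\<omega> \<ge> 2"
  shows "\<exists>(V :: nat set) E. snark V E \<and> oddness V E = \<omega> \<and> real (card V) < 7.5 * real \<omega>"
proof -
  have removed: "(\<Sum>j\<in>{..<3} - {i}. w j) + w i = w 0 + w 1 + w 2" if "i < 3" for i and w :: "nat \<Rightarrow> nat"
  proof -
    have "(\<Sum>j\<in>{..<3} - {i}. w j) + w i = (\<Sum>j<3. w j)"
      using that by (subst sum.remove[of "{..<3}" i]) auto
    then show ?thesis by (simp add: eval_nat_numeral)
  qed
  obtain l where l: "\<omega> = 2 * l" using assms(1) by blast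
  show ?thesis
  proof (cases "even l")
    case False
    \<comment> \<open>The graph has \<open>10 + 30 * k\<close> vertices, against the bound
      \<open>30 * k + 15\<close>. The weight condition holds with equality:
      \<open>\<omega> + 2 * k = (1 + 6 * k) + 1\<close>.\<close>
    then obtain k where k: "\<omega> = 4 * k + 2" using l by (auto elim!: oddE)
    obtain V E d where state: "chain_state V E d (\<lambda>i. 0 + k) (1 + 6 * k) (2 + 4 * k)"
      and card: "card V = card petersen_vertices + 30 * k"
      using chain_state_insert_everywhere[OF petersen_state, of k] by blast
    have "snark V E \<and> oddness V E = \<omega>"
      by (rule chain_state_snark[OF state]) (use assms k removed[of _ "\<lambda>i. k"] in auto)
    then show ?thesis
      using card k by (intro exI[of _ V] exI[of _ E]) (simp add: petersen_vertices_def)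
  next
    case True
    then obtain m where "l = 2 * m" by blast
    then obtain k where k: "\<omega> = 4 * k + 4" using l assms(2) by (cases m) auto
    let ?w = "(\<lambda>_. 0 :: nat)(0 := Suc 0)"
    obtain V0 E0 d0 where start: "chain_state V0 E0 d0 ?w (2 + 2) (3 + 1)"
      and card0: "card V0 = card double_petersen_vertices + 10"
      using chain_state_insert[OF double_petersen_state, of 0] by auto
    obtain V E d where state: "chain_state V E d (\<lambda>i. ?w i + k) (2 + 2 + 6 * k) (3 + 1 + 4 * k)"
      and card: "card V = card V0 + 30 * k"
      using chain_state_insert_everywhere[OF start, of k] by blast
    have "snark V E \<and> oddness V E = \<omega>"
    proof (rule chain_state_snark[OF state])
      fix i :: nat assume "i < 3"
      then show "\<omega> + (\<Sum>j\<in>{..<3} - {i}. ?w j + k) \<le> 2 + 2 + 6 * k + 1"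
        using removed[of i "\<lambda>i. ?w i + k"] k by auto
    qed (use assms k in auto)
    then show ?thesis
      using card card0 k by (intro exI[of _ V] exI[of _ E]) (simp add: double_petersen_vertices_def)
  qed
qed

end
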